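(* Let $\Omega\subset\mathbb{R}^n$ be open and bounded, $s\in(0,1)$, $p\in(1,\infty)$ and $w\in A_p$. Then the embedding $W^{s,p}_{w,0}(\Omega)\hookrightarrow L^p_w(\Omega)$ is compact.
   Context: Throughout $n\ge2$. A weight is a function $w\in L^1_{\mathrm{loc}}(\mathbb{R}^n)$ with $w>0$ a.e.; $w(U)=\int_U w\,dx$; $L^p_w(\Omega)$ has norm $(\int_\Omega|v|^pw\,dx)^{1/p}$. For $1<p<\infty$, $w\in A_p$ means $$[w]_{A_p}:=\sup_{B}\Big(\frac1{|B|}\int_B w\,dx\Big)\Big(\frac1{|B|}\int_B w^{\frac1{1-p}}dx\Big)^{p-1}<\infty,$$ the supremum being over all balls in $\mathbb{R}^n$. For $x,y\in\mathbb{R}^n$ let $B_{x,y}$ be the ball with center $\frac{x+y}2$ and radius $\frac12|x-y|$. Let $0<\lambda\le\Lambda<\infty$ and let $k:\mathbb{R}^n\times\mathbb{R}^n\to[0,\infty)$ be a measurable kernel with $\lambda\frac{w(x)w(y)}{w(B_{x,y})}\le k(x,y)\le\Lambda\frac{w(x)w(y)}{w(B_{x,y})}$. Set $$\mathcal{J}^s_{p,w}(v)=s(1-s)\int_{\mathbb{R}^n}\int_{\mathbb{R}^n}\Big(\frac{|v(x)-v(y)|}{|x-y|^s}\Big)^p k(x,y)\,dx\,dy,$$ $W^{s,p}_w(\mathbb{R}^n)=\{v\in L^1_{\mathrm{loc}}(\mathbb{R}^n):\mathcal{J}^s_{p,w}(v)<\infty\}$, $|v|_{W^{s,p}_w(\mathbb{R}^n)}=(\mathcal{J}^s_{p,w}(v))^{1/p}$,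 and $W^{s,p}_{w,0}(\Omega)=\{v\in W^{s,p}_w(\mathbb{R}^n): v=0 \text{ a.e. on }\Omega^c\}$, normed by $|\cdot|_{W^{s,p}_w(\mathbb{R}^n)}$. *)

theory Defs
  imports "HOL-Analysis.Analysis"
begin

text \<open>
  Norms and energies take values in \<^typ>\<open>ennreal\<close>, so that an infinite integral is really infinite.
  Throughout, function spaces consist of functions rather than a.e.-classes, and ``measurable'' means
  Lebesgue measurable.
\<close>

text \<open>Powers in \<open>[0,\<infinity>]\<close>, only meant for exponents \<open>a > 0\<close> (so that \<open>\<infinity>\<close> to the power \<open>a\<close> is \<open>\<infinity>\<close>).\<close>

definition enn_powr :: "ennreal \<Rightarrow> real \<Rightarrow> ennreal" where
  "enn_powr x a = (if x = \<infinity> then \<infinity> else ennreal (enn2real x powr a))"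

definition L1_loc :: "('a::euclidean_space \<Rightarrow> real) set" where
  "L1_loc = {v. \<forall>K. compact K \<longrightarrow> v absolutely_integrable_on K}"

definition weight :: "('a::euclidean_space \<Rightarrow> real) \<Rightarrow> bool" where
  "weight w \<longleftrightarrow> w \<in> L1_loc \<and> (AE x in lebesgue. 0 < w x)"

definition weight_mass :: "('a::euclidean_space \<Rightarrow> real) \<Rightarrow> 'a set \<Rightarrow> real" where
  "weight_mass w U = (LINT x:U|lebesgue. w x)"

definition ball_avg :: "('a::euclidean_space \<Rightarrow> real) \<Rightarrow> 'a \<Rightarrow> real \<Rightarrow> ennreal" where
  "ball_avg f c r = (\<integral>\<^sup>+x\<in>ball c r. ennreal (f x) \<partial>lebesgue) / emeasure lebesgue (ball c r)"

definition Ap_const :: "real \<Rightarrow> ('a::euclidean_space \<Rightarrow> real) \<Rightarrow> ennreal" where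
  "Ap_const p w = (SUP (c, r) \<in> UNIV \<times> {0<..}.
     ball_avg w c r * enn_powr (ball_avg (\<lambda>x. w x powr (1 / (1 - p))) c r) (p - 1))"

definition Ap :: "real \<Rightarrow> ('a::euclidean_space \<Rightarrow> real) set" where
  "Ap p = {w. weight w \<and> Ap_const p w < \<infinity>}"

definition mid_ball :: "'a::euclidean_space \<Rightarrow> 'a \<Rightarrow> 'a set" where
  "mid_ball x y = ball (midpoint x y) (norm (x - y) / 2)"

text \<open>The two-sided bound is imposed for a.e. \<open>(x, y)\<close>, since \<open>w\<close> is only determined a.e. and
  \<open>mid_ball x x\<close> is empty, so that the quotient is meaningless on the (null) diagonal.\<close>

definition admissible_kernel ::
  "real \<Rightarrow> real \<Rightarrow> ('a::euclidean_space \<Rightarrow> real) \<Rightarrow> ('a \<Rightarrow> 'a \<Rightarrow> real) \<Rightarrow> bool" where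
  "admissible_kernel lam Lam w k \<longleftrightarrow>
     (\<lambda>(x, y). k x y) \<in> borel_measurable lebesgue \<and>
     (\<forall>x y. 0 \<le> k x y) \<and>
     (AE (x, y) in lebesgue.
        lam * (w x * w y / weight_mass w (mid_ball x y)) \<le> k x y \<and>
        k x y \<le> Lam * (w x * w y / weight_mass w (mid_ball x y)))"

text \<open>The dependence on the weight is only through the kernel \<open>k\<close>.\<close>

definition energy ::
  "('a::euclidean_space \<Rightarrow> 'a \<Rightarrow> real) \<Rightarrow> real \<Rightarrow> real \<Rightarrow> ('a \<Rightarrow> real) \<Rightarrow> ennreal" where
  "energy k s p v = ennreal (s * (1 - s)) *
     (\<integral>\<^sup>+y. \<integral>\<^sup>+x. ennreal ((\<bar>v x - v y\<bar> / norm (x - y) powr s) powr p * k x y)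
        \<partial>lebesgue \<partial>lebesgue)"

definition W_space ::
  "('a::euclidean_space \<Rightarrow> 'a \<Rightarrow> real) \<Rightarrow> real \<Rightarrow> real \<Rightarrow> ('a \<Rightarrow> real) set" where
  "W_space k s p = {v \<in> L1_loc. energy k s p v < \<infinity>}"

definition W_norm ::
  "('a::euclidean_space \<Rightarrow> 'a \<Rightarrow> real) \<Rightarrow> real \<Rightarrow> real \<Rightarrow> ('a \<Rightarrow> real) \<Rightarrow> ennreal" where
  "W_norm k s p v = enn_powr (energy k s p v) (1 / p)"

definition W0_space ::
  "('a::euclidean_space \<Rightarrow> 'a \<Rightarrow> real) \<Rightarrow> real \<Rightarrow> real \<Rightarrow> 'a set \<Rightarrow> ('a \<Rightarrow> real) set" where
  "W0_space k s p \<Omega> = {v \<in> W_space k s p. AE x in lebesgue. x \<notin> \<Omega> \<longrightarrow> v x = 0}"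

text \<open>Elements of \<open>L\<^sup>p\<^sub>w(\<Omega>)\<close> are represented by functions on the whole space whose values
  outside \<open>\<Omega>\<close> are irrelevant; the embedding of \<open>W0_space\<close> is then plain inclusion.\<close>

definition Lpw_norm ::
  "real \<Rightarrow> ('a::euclidean_space \<Rightarrow> real) \<Rightarrow> 'a set \<Rightarrow> ('a \<Rightarrow> real) \<Rightarrow> ennreal" where
  "Lpw_norm p w \<Omega> v = enn_powr (\<integral>\<^sup>+x\<in>\<Omega>. ennreal (\<bar>v x\<bar> powr p * w x) \<partial>lebesgue) (1 / p)"

definition Lpw_space ::
  "real \<Rightarrow> ('a::euclidean_space \<Rightarrow> real) \<Rightarrow> 'a set \<Rightarrow> ('a \<Rightarrow> real) set" where
  "Lpw_space p w \<Omega> = {v \<in> borel_measurable (lebesgue_on \<Omega>). Lpw_norm p w \<Omega> v < \<infinity>}"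

text \<open>\<open>X\<close> with norm \<open>NX\<close> embeds compactly into \<open>Y\<close> with norm \<open>NY\<close>: the inclusion is defined and
  continuous, and every \<open>X\<close>-bounded sequence has a subsequence that converges in \<open>Y\<close>.\<close>

definition compact_embedding ::
  "('a \<Rightarrow> real) set \<Rightarrow> (('a \<Rightarrow> real) \<Rightarrow> ennreal) \<Rightarrow>
   ('a \<Rightarrow> real) set \<Rightarrow> (('a \<Rightarrow> real) \<Rightarrow> ennreal) \<Rightarrow> bool" where
  "compact_embedding X NX Y NY \<longleftrightarrow>
     X \<subseteq> Y \<and>
     (\<exists>C::real. \<forall>v\<in>X. NY v \<le> ennreal C * NX v) \<and>
     (\<forall>v :: nat \<Rightarrow> 'a \<Rightarrow> real. \<forall>M::real.
        (\<forall>j. v j \<in> X \<and> NX (v j) \<le> ennreal M) \<longrightarrow>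
        (\<exists>u\<in>Y. \<exists>r. strict_mono r \<and> (\<lambda>j. NY (\<lambda>x. v (r j) x - u x)) \<longlonglongrightarrow> 0))"

end

theory Submission
  imports Defs "HOL-Library.Diagonal_Subsequence"
begin

text \<open>
Write \<open>\<mu>\<close> for the measure with density \<open>w\<close>. Up to constants, the energy of \<open>v\<close> is the double integral
of \<open>\<bar>v x - v y\<bar> powr p / (norm (x - y) powr (s * p) * \<mu> (mid_ball x y))\<close> against \<open>\<mu> \<times> \<mu>\<close>, and both
halves of the theorem come from restricting it to well chosen products of sets
(\<open>energy_lower_bound\<close>).

Continuity is a Friedrichs inequality. If \<open>v\<close> vanishes off the bounded set \<open>\<Omega>\<close>, pair the points of
\<open>\<Omega>\<close> with those of a fixed ball outside \<open>\<Omega>\<close>: there \<open>v y = 0\<close>, the distances are bounded and the balls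
between the points lie in one large ball, so what remains of the energy is a positive multiple of
the \<open>p\<close>-th power of the weighted norm of \<open>v\<close> (\<open>friedrichs_inequality\<close>).

Compactness comes from pairing the points of each cube of a grid of mesh \<open>h\<close> with each other.
Distances are then \<open>O(h)\<close>, and the \<open>A\<^sub>p\<close> condition bounds the mass of a ball around a cube by a fixed
multiple of the mass of the cube, independently of \<open>h\<close> (\<open>Ap_grid_ball_mass_le\<close>). Hence the sum over
all cubes \<open>Q\<close> of the mean oscillations
\<open>1 / \<mu> Q\<close> times the integral of \<open>\<bar>v x - v y\<bar> powr p\<close> over \<open>Q \<times> Q\<close> is at most a constant times
\<open>h powr (s * p)\<close> times the energy. In each cube some value \<open>a = v y\<close> does almost as well as the mean
over \<open>y\<close>, so \<open>v\<close> is close to a step function, uniformly over functions of bounded energy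
(\<open>energy_bounded_near_step_functions\<close>). Using a value of \<open>v\<close> rather than its average avoids
Jensen's inequality; the price is that the step function does not depend linearly on \<open>v\<close>, which
does no harm below.

By the Friedrichs inequality the values of the step functions are bounded, so rounding them sorts a
bounded sequence into finitely many classes of small diameter. The pigeonhole principle and a
diagonal argument give a Cauchy subsequence (\<open>finite_colouring_of_step_approximable\<close>,
\<open>Cauchy_subseq_of_finite_colourings\<close>), which converges because the weighted space is complete
(\<open>Lp_Cauchy_imp_convergent\<close>).
\<close>

section \<open>Lebesgue measure with a weight as density\<close>

definition weight_measure :: "('a::euclidean_space \<Rightarrow> real) \<Rightarrow> 'a measure" where
  "weight_measure w = density lebesgue (\<lambda>x. ennreal (w x))"

lemma sets_weight_measure [measurable_cong, simp]: "sets (weight_measure w) = sets lebesgue"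
  and space_weight_measure [simp]: "space (weight_measure w) = UNIV"
  by (simp_all add: weight_measure_def)

lemma L1_loc_borel_measurable:
  fixes v :: "'a::euclidean_space \<Rightarrow> real"
  assumes "v \<in> L1_loc"
  shows "v \<in> borel_measurable lebesgue"
proof (rule borel_measurable_LIMSEQ_real)
  show "(\<lambda>n. indicator (cball 0 (real n)) x * v x) \<longlonglongrightarrow> v x" for x
  proof (rule tendsto_eventually)
    obtain N where "norm x \<le> real N" using real_arch_simple by blast
    then show "\<forall>\<^sub>F n in sequentially. indicator (cball 0 (real n)) x * v x = v x"
      by (intro eventually_sequentiallyI[of N]) (auto simp: indicator_def)
  qed
  show "(\<lambda>x. indicator (cball 0 (real n)) x * v x) \<in> borel_measurable lebesgue" for n
  proof -
    have "v absolutely_integrable_on cball 0 (real n)"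
      using assms by (auto simp: L1_loc_def)
    then show ?thesis
      by (auto simp: set_integrable_def dest: borel_measurable_integrable)
  qed
qed

lemma weight_borel_measurable: "weight w \<Longrightarrow> w \<in> borel_measurable lebesgue"
  by (simp add: weight_def L1_loc_borel_measurable)

text \<open>
Positivity of \<open>w\<close> almost everywhere makes the two measures mutually absolutely continuous.
\<close>

lemma AE_weight_measure_iff:
  assumes "weight w"
  shows "(AE x in weight_measure w. P x) \<longleftrightarrow> (AE x in lebesgue. P x)"
proof -
  have [measurable]: "w \<in> borel_measurable lebesgue" using weight_borel_measurable[OF assms] .
  have pos: "AE x in lebesgue. 0 < w x" using assms by (simp add: weight_def)
  have "(AE x in weight_measure w. P x) \<longleftrightarrow> (AE x in lebesgue. 0 < ennreal (w x) \<longrightarrow> P x)"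
    unfolding weight_measure_def by (rule AE_density) simp
  also have "\<dots> \<longleftrightarrow> (AE x in lebesgue. P x)"
    using pos by (intro iffI; elim AE_mp) auto
  finally show ?thesis .
qed

lemma emeasure_weight_measure:
  assumes "weight w" "S \<in> sets lebesgue"
  shows "emeasure (weight_measure w) S = (\<integral>\<^sup>+x\<in>S. ennreal (w x) \<partial>lebesgue)"
  unfolding weight_measure_def
  using weight_borel_measurable[OF assms(1)] assms(2) by (intro emeasure_density) auto

lemma emeasure_weight_measure_eq_weight_mass:
  fixes w :: "'a::euclidean_space \<Rightarrow> real"
  assumes w: "weight w" and S: "S \<in> sets lebesgue" and bdd: "bounded S"
  shows "emeasure (weight_measure w) S = ennreal (weight_mass w S)"
proof -
  have [measurable]: "w \<in> borel_measurable lebesgue" using weight_borel_measurable[OF w] .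
  note S[measurable]
  obtain r where r: "S \<subseteq> ball 0 r" using bounded_subset_ballD[OF bdd] by blast
  have "w absolutely_integrable_on cball 0 r" using w by (auto simp: weight_def L1_loc_def)
  then have int: "set_integrable lebesgue S w"
    by (rule set_integrable_subset) (use r S ball_subset_cball in \<open>auto simp: subset_eq\<close>)
  have "AE x in lebesgue. 0 \<le> w x" using w unfolding weight_def by (auto elim: AE_mp)
  then have "(\<integral>\<^sup>+x. ennreal (indicator S x *\<^sub>R w x) \<partial>lebesgue) = ennreal (weight_mass w S)"
    unfolding weight_mass_def set_lebesgue_integral_def
    using int unfolding set_integrable_def by (intro nn_integral_eq_integral) (auto elim!: AE_mp)
  moreover have "ennreal (indicator S x *\<^sub>R w x) = ennreal (w x) * indicator S x" for x
    by (auto simp: indicator_def)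
  ultimately show ?thesis by (simp add: emeasure_weight_measure[OF w S])
qed

lemma emeasure_weight_measure_finite:
  assumes "weight w" "S \<in> sets lebesgue" "bounded S"
  shows "emeasure (weight_measure w) S < \<infinity>"
  using emeasure_weight_measure_eq_weight_mass[OF assms] by simp

lemma emeasure_weight_measure_pos:
  assumes w: "weight w" and S: "S \<in> sets lebesgue" and pos: "0 < emeasure lebesgue S"
  shows "0 < emeasure (weight_measure w) S"
proof (rule ccontr)
  assume "\<not> ?thesis"
  then have "S \<in> null_sets (weight_measure w)" using S by (simp add: null_sets_def)
  then have "AE x in lebesgue. x \<notin> S" using AE_not_in AE_weight_measure_iff[OF w] by blast
  then have "S \<in> null_sets lebesgue" using S AE_iff_null_sets by blast
  then show False using pos by (simp add: null_sets_def)
qed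

lemma sigma_finite_weight_measure:
  fixes w :: "'a::euclidean_space \<Rightarrow> real"
  assumes "weight w"
  shows "sigma_finite_measure (weight_measure w)"
proof
  let ?A = "range (\<lambda>n::nat. ball (0::'a) (real n))"
  have "\<Union>?A = UNIV"
  proof -
    have "\<exists>n. x \<in> ball (0::'a) (real n)" for x
      using reals_Archimedean2[of "norm x"] by auto
    then show ?thesis by blast
  qed
  moreover have "emeasure (weight_measure w) (ball 0 (real n)) \<noteq> \<infinity>" for n
    using emeasure_weight_measure_finite[OF assms, of "ball 0 (real n)"] by auto
  ultimately show "\<exists>A. countable A \<and> A \<subseteq> sets (weight_measure w) \<and> \<Union>A = space (weight_measure w)
      \<and> (\<forall>a\<in>A. emeasure (weight_measure w) a \<noteq> \<infinity>)"
    by (intro exI[of _ ?A]) auto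
qed

text \<open>
The product of two copies of \<^term>\<open>lebesgue\<close> is smaller than \<^term>\<open>lebesgue\<close> on the product space, so
Fubini's theorem for null sets is applied to Borel measure, where the two agree; null sets do not
change under completion.
\<close>

lemma AE_lebesgue_prod_swap:
  fixes P :: "'a::euclidean_space \<Rightarrow> 'b::euclidean_space \<Rightarrow> bool"
  assumes "AE (x, y) in lebesgue. P x y"
  shows "AE y in lebesgue. AE x in lebesgue. P x y"
proof -
  have "AE (x, y) in lborel. P x y" using assms AE_completion_iff by blast
  then have "AE (x, y) in lborel \<Otimes>\<^sub>M lborel. P x y" by (simp only: lborel_prod)
  then have "AE (y, x) in lborel \<Otimes>\<^sub>M lborel. P x y"
    by (subst (asm) lborel_pair.distr_pair_swap) (auto dest!: AE_distrD[rotated] simp: case_prod_beta)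
  from lborel_pair.AE_pair[OF this] have "AE y in lborel. AE x in lborel. P x y" by simp
  then show ?thesis by (simp add: AE_completion_iff)
qed

lemma emeasure_lebesgue_ball:
  fixes c :: "'a::euclidean_space"
  assumes "0 \<le> r"
  shows "emeasure lebesgue (ball c r) = ennreal (unit_ball_vol (real DIM('a)) * r ^ DIM('a))"
  using emeasure_ball[OF assms, of c] by simp

lemma weight_mass_ball_pos:
  fixes w :: "'a::euclidean_space \<Rightarrow> real"
  assumes w: "weight w" and "0 < r"
  shows "0 < weight_mass w (ball c r)"
proof -
  have "0 < emeasure lebesgue (ball c r)"
    using \<open>0 < r\<close> by (simp only: emeasure_lebesgue_ball less_imp_le) simp
  then have "0 < ennreal (weight_mass w (ball c r))"
    using emeasure_weight_measure_pos[OF w, of "ball c r"]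
      emeasure_weight_measure_eq_weight_mass[OF w, of "ball c r"] by simp
  then show ?thesis by simp
qed

lemma weight_mass_nonneg:
  assumes "weight w"
  shows "0 \<le> weight_mass w S"
proof -
  have "AE x in lebesgue. 0 \<le> indicator S x *\<^sub>R w x"
    using assms unfolding weight_def by (auto elim!: AE_mp simp: indicator_def)
  then show ?thesis
    unfolding weight_mass_def set_lebesgue_integral_def by (rule integral_nonneg_AE)
qed

section \<open>Lower bounds for the energy\<close>

lemma weight_mass_mid_ball:
  fixes w :: "'a::euclidean_space \<Rightarrow> real"
  assumes w: "weight w" and "x \<noteq> y" and sub: "mid_ball x y \<subseteq> D"
    and D: "D \<in> sets lebesgue" "bounded D"
  shows "0 < weight_mass w (mid_ball x y)" "weight_mass w (mid_ball x y) \<le> weight_mass w D"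
proof -
  let ?U = "mid_ball x y"
  have U: "?U \<in> sets lebesgue" "bounded ?U" by (auto simp: mid_ball_def)
  show pos: "0 < weight_mass w ?U"
    unfolding mid_ball_def using \<open>x \<noteq> y\<close> by (intro weight_mass_ball_pos[OF w]) simp
  have "ennreal (weight_mass w ?U) \<le> ennreal (weight_mass w D)"
    using emeasure_mono[OF sub, of "weight_measure w"] D(1)
    by (simp add: emeasure_weight_measure_eq_weight_mass[OF w] U D)
  then show "weight_mass w ?U \<le> weight_mass w D"
    using pos by (simp add: ennreal_le_iff2)
qed

text \<open>
The kernel only decreases when the distance is replaced by an upper bound \<open>d\<close> and the ball between
\<open>x\<close> and \<open>y\<close> by a set \<open>D\<close> containing it. On the diagonal, where \<open>weight_mass w (mid_ball x x) = 0\<close>, both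
sides vanish because \<open>0 powr p = 0\<close>.
\<close>

lemma energy_integrand_ge:
  fixes w :: "'a::euclidean_space \<Rightarrow> real"
  assumes w: "weight w" and sub: "mid_ball x y \<subseteq> D" and D: "D \<in> sets lebesgue" "bounded D"
    and d: "norm (x - y) \<le> d" and par: "0 < s" "0 < p" "0 < lam"
    and pos: "0 < w x" "0 < w y"
    and k: "lam * (w x * w y / weight_mass w (mid_ball x y)) \<le> k x y"
  shows "lam / d powr (s * p) / weight_mass w D * \<bar>v x - v y\<bar> powr p * (w x * w y)
    \<le> (\<bar>v x - v y\<bar> / norm (x - y) powr s) powr p * k x y"
proof (cases "x = y")
  case True
  then show ?thesis using par by simp
next
  case False
  let ?m = "weight_mass w (mid_ball x y)"
  note m = weight_mass_mid_ball[OF w False sub D]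
  have n0: "0 < norm (x - y)" using False by simp
  have d0: "0 < d" using n0 d by linarith
  have np: "norm (x - y) powr (s * p) \<le> d powr (s * p)"
    using d par by (intro powr_mono2) auto
  have eq: "(\<bar>v x - v y\<bar> / norm (x - y) powr s) powr p
      = \<bar>v x - v y\<bar> powr p / norm (x - y) powr (s * p)"
    by (simp add: powr_divide powr_powr)
  have "lam / d powr (s * p) / weight_mass w D * \<bar>v x - v y\<bar> powr p * (w x * w y)
     \<le> lam / norm (x - y) powr (s * p) / ?m * \<bar>v x - v y\<bar> powr p * (w x * w y)"
    using m np n0 d0 pos par
    by (intro mult_right_mono frac_le divide_left_mono) (auto intro!: divide_nonneg_nonneg mult_pos_pos)
  also have "\<dots> = \<bar>v x - v y\<bar> powr p / norm (x - y) powr (s * p) * (lam * (w x * w y / ?m))"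
    by (simp add: field_simps)
  also have "\<dots> \<le> \<bar>v x - v y\<bar> powr p / norm (x - y) powr (s * p) * k x y"
    using k by (intro mult_left_mono) auto
  finally show ?thesis by (simp add: eq)
qed

text \<open>
Restricting the energy to finitely many disjoint products \<open>Q1 z \<times> Q2 z\<close>, on each of which the kernel is
bounded below by a constant times \<open>w x * w y\<close>. The minorant \<open>F\<close> used in the proof is composed of
functions of \<open>x\<close> alone and of \<open>y\<close> alone, hence measurable for the product \<open>\<sigma>\<close>-algebra, whereas the integrand of the energy is only
Lebesgue measurable on the product space; this is why the integral is split after passing to \<open>F\<close>.
\<close>

lemma energy_lower_bound:
  fixes w :: "'a::euclidean_space \<Rightarrow> real" and Q1 Q2 D :: "'z \<Rightarrow> 'a set"
  assumes w: "weight w" and adm: "admissible_kernel lam Lam w k"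
    and par: "0 < s" "s < 1" "0 < p" "0 < lam"
    and v: "v \<in> borel_measurable lebesgue"
    and fin: "finite Z"
    and Q: "\<And>z. z \<in> Z \<Longrightarrow> Q1 z \<in> sets lebesgue" "\<And>z. z \<in> Z \<Longrightarrow> Q2 z \<in> sets lebesgue"
    and disj: "disjoint_family_on (\<lambda>z. Q1 z \<times> Q2 z) Z"
    and D: "\<And>z. z \<in> Z \<Longrightarrow> D z \<in> sets lebesgue" "\<And>z. z \<in> Z \<Longrightarrow> bounded (D z)"
    and sub: "\<And>z x y. z \<in> Z \<Longrightarrow> x \<in> Q1 z \<Longrightarrow> y \<in> Q2 z \<Longrightarrow> mid_ball x y \<subseteq> D z"
    and d: "\<And>z x y. z \<in> Z \<Longrightarrow> x \<in> Q1 z \<Longrightarrow> y \<in> Q2 z \<Longrightarrow> norm (x - y) \<le> d"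
  shows "ennreal (s * (1 - s)) * (\<Sum>z\<in>Z. ennreal (lam / d powr (s * p) / weight_mass w (D z)) *
      (\<integral>\<^sup>+y\<in>Q2 z. (\<integral>\<^sup>+x\<in>Q1 z. ennreal (\<bar>v x - v y\<bar> powr p) \<partial>weight_measure w) \<partial>weight_measure w))
    \<le> energy k s p v"
proof -
  let ?M = "weight_measure w"
  interpret M: sigma_finite_measure ?M by (rule sigma_finite_weight_measure[OF w])
  have wm[measurable]: "w \<in> borel_measurable lebesgue" using weight_borel_measurable[OF w] .
  note v[measurable]
  define b where "b z = lam / d powr (s * p) / weight_mass w (D z)" for z
  define F where "F y x = (\<Sum>z\<in>Z. ennreal (b z) *
      (indicator (Q2 z) y * (ennreal (\<bar>v x - v y\<bar> powr p) * indicator (Q1 z) x)))" for y x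
  have b0: "0 \<le> b z" for z
    using par weight_mass_nonneg[OF w] by (simp add: b_def)
  have Qm[measurable]: "Q1 z \<in> sets lebesgue" "Q2 z \<in> sets lebesgue" if "z \<in> Z" for z
    using Q that by auto
  have inner: "(\<lambda>y. \<integral>\<^sup>+x. ennreal (\<bar>v x - v y\<bar> powr p) * indicator (Q1 z) x \<partial>?M)
      \<in> borel_measurable lebesgue" if "z \<in> Z" for z
  proof -
    note Qm[OF that, measurable]
    have "(\<lambda>(y, x). ennreal (\<bar>v x - v y\<bar> powr p) * indicator (Q1 z) x)
        \<in> borel_measurable (lebesgue \<Otimes>\<^sub>M ?M)"
      by measurable
    then show ?thesis by (rule M.borel_measurable_nn_integral)
  qed
  have Fint: "(\<integral>\<^sup>+x. F y x \<partial>?M) = (\<Sum>z\<in>Z. ennreal (b z) *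
      (indicator (Q2 z) y * (\<integral>\<^sup>+x. ennreal (\<bar>v x - v y\<bar> powr p) * indicator (Q1 z) x \<partial>?M)))" for y
  proof -
    have "(\<integral>\<^sup>+x. F y x \<partial>?M) = (\<Sum>z\<in>Z. \<integral>\<^sup>+x. ennreal (b z) *
      (indicator (Q2 z) y * (ennreal (\<bar>v x - v y\<bar> powr p) * indicator (Q1 z) x)) \<partial>?M)"
      unfolding F_def by (rule nn_integral_sum) measurable
    also have "\<dots> = (\<Sum>z\<in>Z. ennreal (b z) *
      (indicator (Q2 z) y * (\<integral>\<^sup>+x. ennreal (\<bar>v x - v y\<bar> powr p) * indicator (Q1 z) x \<partial>?M)))"
    proof (rule sum.cong[OF refl])
      fix z assume "z \<in> Z"
      note Qm[OF this, measurable]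
      have [measurable]: "(\<lambda>x. ennreal (\<bar>v x - v y\<bar> powr p) * indicator (Q1 z) x) \<in> borel_measurable ?M"
        by measurable
      show "(\<integral>\<^sup>+x. ennreal (b z) *
          (indicator (Q2 z) y * (ennreal (\<bar>v x - v y\<bar> powr p) * indicator (Q1 z) x)) \<partial>?M) =
        ennreal (b z) *
          (indicator (Q2 z) y * (\<integral>\<^sup>+x. ennreal (\<bar>v x - v y\<bar> powr p) * indicator (Q1 z) x \<partial>?M))"
        by (simp add: nn_integral_cmult)
    qed
    finally show ?thesis .
  qed
  have Fm: "(\<lambda>x. F y x) \<in> borel_measurable lebesgue" for y
    unfolding F_def by measurable
  have FIm: "(\<lambda>y. \<integral>\<^sup>+x. F y x \<partial>?M) \<in> borel_measurable lebesgue"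
    unfolding Fint using inner by (intro borel_measurable_sum) auto
  have total: "(\<integral>\<^sup>+y. (\<integral>\<^sup>+x. F y x \<partial>?M) \<partial>?M) = (\<Sum>z\<in>Z. ennreal (b z) *
      (\<integral>\<^sup>+y\<in>Q2 z. (\<integral>\<^sup>+x\<in>Q1 z. ennreal (\<bar>v x - v y\<bar> powr p) \<partial>?M) \<partial>?M))"
  proof -
    have "(\<integral>\<^sup>+y. (\<integral>\<^sup>+x. F y x \<partial>?M) \<partial>?M) = (\<Sum>z\<in>Z. \<integral>\<^sup>+y. ennreal (b z) *
      (indicator (Q2 z) y * (\<integral>\<^sup>+x. ennreal (\<bar>v x - v y\<bar> powr p) * indicator (Q1 z) x \<partial>?M)) \<partial>?M)"
      unfolding Fint using inner by (intro nn_integral_sum) auto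
    also have "\<dots> = (\<Sum>z\<in>Z. ennreal (b z) * (\<integral>\<^sup>+y. 
      indicator (Q2 z) y * (\<integral>\<^sup>+x. ennreal (\<bar>v x - v y\<bar> powr p) * indicator (Q1 z) x \<partial>?M) \<partial>?M))"
      using inner by (intro sum.cong refl nn_integral_cmult) auto
    finally show ?thesis by (simp add: mult.commute)
  qed
  have dens: "(\<integral>\<^sup>+x. f x \<partial>?M) = (\<integral>\<^sup>+x. ennreal (w x) * f x \<partial>lebesgue)"
    if "f \<in> borel_measurable lebesgue" for f
    unfolding weight_measure_def using that by (intro nn_integral_density) auto
  have wpos: "AE x in lebesgue. 0 < w x" using w by (simp add: weight_def)
  have "AE (x, y) in lebesgue. lam * (w x * w y / weight_mass w (mid_ball x y)) \<le> k x y"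
    using adm unfolding admissible_kernel_def by (auto elim!: AE_mp)
  from AE_lebesgue_prod_swap[OF this]
  have ae: "AE y in lebesgue. 0 < w y \<and> 
      (AE x in lebesgue. 0 < w x \<and> lam * (w x * w y / weight_mass w (mid_ball x y)) \<le> k x y)"
    using wpos by (auto elim!: AE_mp)
  have pw: "ennreal (w y) * (ennreal (w x) * F y x)
      \<le> ennreal ((\<bar>v x - v y\<bar> / norm (x - y) powr s) powr p * k x y)"
    if "0 < w y" "0 < w x" "lam * (w x * w y / weight_mass w (mid_ball x y)) \<le> k x y" for x y
  proof (cases "\<exists>z\<in>Z. x \<in> Q1 z \<and> y \<in> Q2 z")
    case False
    then have "F y x = 0" unfolding F_def by (intro sum.neutral) (auto simp: indicator_def)
    then show ?thesis by simp
  next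
    case True
    then obtain z where z: "z \<in> Z" "x \<in> Q1 z" "y \<in> Q2 z" by auto
    have "F y x = ennreal (b z) * (indicator (Q2 z) y * (ennreal (\<bar>v x - v y\<bar> powr p) * indicator (Q1 z) x))"
    proof -
      have "\<not> (x \<in> Q1 z' \<and> y \<in> Q2 z')" if "z' \<in> Z - {z}" for z'
        using disj that z unfolding disjoint_family_on_def by blast
      then show ?thesis
        unfolding F_def
        by (subst sum.remove[OF fin z(1)], subst sum.neutral) (auto simp: indicator_def)
    qed
    also have "\<dots> = ennreal (b z * \<bar>v x - v y\<bar> powr p)"
      using z b0 by (simp add: ennreal_mult)
    finally have "ennreal (w y) * (ennreal (w x) * F y x) = ennreal (b z * \<bar>v x - v y\<bar> powr p * (w x * w y))"
      using b0 that by (simp add: ennreal_mult[symmetric] mult_ac)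
    also have "\<dots> \<le> ennreal ((\<bar>v x - v y\<bar> / norm (x - y) powr s) powr p * k x y)"
      unfolding b_def using energy_integrand_ge[OF w sub[OF z] D[OF z(1)] d[OF z]] par that
      by (intro ennreal_leI) blast
    finally show ?thesis .
  qed
  have "(\<integral>\<^sup>+y. (\<integral>\<^sup>+x. F y x \<partial>?M) \<partial>?M)
     = (\<integral>\<^sup>+y. ennreal (w y) * (\<integral>\<^sup>+x. ennreal (w x) * F y x \<partial>lebesgue) \<partial>lebesgue)"
    by (subst dens[OF FIm]) (simp only: dens[OF Fm])
  also have "\<dots> = (\<integral>\<^sup>+y. \<integral>\<^sup>+x. ennreal (w y) * (ennreal (w x) * F y x) \<partial>lebesgue \<partial>lebesgue)"
    using Fm by (intro nn_integral_cong nn_integral_cmult[symmetric]) auto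
  also have "\<dots> \<le> (\<integral>\<^sup>+y. \<integral>\<^sup>+x. ennreal ((\<bar>v x - v y\<bar> / norm (x - y) powr s) powr p * k x y)
        \<partial>lebesgue \<partial>lebesgue)"
  proof (rule nn_integral_mono_AE, rule AE_mp[OF ae], intro AE_I2 impI, elim conjE)
    fix y assume y: "0 < w y"
      and x: "AE x in lebesgue. 0 < w x \<and> lam * (w x * w y / weight_mass w (mid_ball x y)) \<le> k x y"
    show "(\<integral>\<^sup>+x. ennreal (w y) * (ennreal (w x) * F y x) \<partial>lebesgue)
      \<le> (\<integral>\<^sup>+x. ennreal ((\<bar>v x - v y\<bar> / norm (x - y) powr s) powr p * k x y) \<partial>lebesgue)"
      by (rule nn_integral_mono_AE, rule AE_mp[OF x], intro AE_I2 impI, elim conjE) (rule pw[OF y])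
  qed
  finally show ?thesis
    unfolding energy_def total b_def by (intro mult_left_mono) auto
qed

text \<open>
A ball disjoint from \<open>\<Omega>\<close> supplies points \<open>y\<close> with \<open>v y = 0\<close>, so that \<open>\<bar>v x - v y\<bar> = \<bar>v x\<bar>\<close>.
\<close>

lemma friedrichs_inequality:
  fixes w :: "'a::euclidean_space \<Rightarrow> real"
  assumes w: "weight w" and adm: "admissible_kernel lam Lam w k"
    and par: "0 < s" "s < 1" "0 < p" "0 < lam" and bdd: "bounded \<Omega>"
  obtains C where "0 \<le> C" and "\<And>v. v \<in> borel_measurable lebesgue \<Longrightarrow> (AE x in lebesgue. x \<notin> \<Omega> \<longrightarrow> v x = 0) \<Longrightarrow>
      (\<integral>\<^sup>+x. ennreal (\<bar>v x\<bar> powr p) \<partial>weight_measure w) \<le> ennreal C * energy k s p v"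
proof -
  let ?M = "weight_measure w"
  obtain R where R: "0 < R" "\<Omega> \<subseteq> ball 0 R" using bounded_subset_ballD[OF bdd] by blast
  obtain c :: 'a where c: "norm c = R + 1" using vector_choose_size[of "R + 1"] R by auto
  define d where "d = 2 * (R + 2)"
  define D where "D = ball (0::'a) d"
  have d0: "0 < d" using R by (simp add: d_def)
  have AD: "0 < weight_mass w (ball c 1)" "0 < weight_mass w D"
    using weight_mass_ball_pos[OF w] d0 by (auto simp: D_def)
  define b where "b = lam / d powr (s * p) / weight_mass w D"
  have b: "0 < b" using AD d0 par by (simp add: b_def)
  define N where "N = s * (1 - s) * b * weight_mass w (ball c 1)"
  have N: "0 < N" unfolding N_def using AD b par by (intro mult_pos_pos) auto
  define C where "C = 1 / N"
  have far: "y \<notin> \<Omega>" if "y \<in> ball c 1" for y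
  proof
    assume "y \<in> \<Omega>"
    then have "norm y < R" using R by auto
    moreover have "norm (c - y) < 1" using that by (simp add: dist_norm)
    ultimately show False using c norm_triangle_sub[of c y] by linarith
  qed
  show thesis
  proof (rule that[of C])
    show "0 \<le> C" using N by (simp add: C_def)
    fix v :: "'a \<Rightarrow> real" 
    assume v[measurable]: "v \<in> borel_measurable lebesgue" and v0: "AE x in lebesgue. x \<notin> \<Omega> \<longrightarrow> v x = 0"
    have geo: "mid_ball x y \<subseteq> D \<and> norm (x - y) \<le> d" if "x \<in> ball 0 R" "y \<in> ball c 1" for x y
    proof -
      have x: "norm x < R" using that by simp
      have "norm (c - y) < 1" using that by (simp add: dist_norm)
      then have y: "norm y < R + 2" using c norm_triangle_sub[of y c] by (simp add: norm_minus_commute)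
      have xy: "norm (x - y) < d" using x y norm_triangle_ineq4[of x y] by (simp add: d_def)
      have "2 * norm (midpoint x y) \<le> norm x + norm y"
        using norm_triangle_ineq[of x y] by (simp add: midpoint_def)
      moreover have "norm x + norm y \<le> 2 * (R + 2)" using x y by simp
      ultimately have m: "norm (midpoint x y) \<le> R + 2" by simp
      have "mid_ball x y \<subseteq> D"
      proof
        fix u assume "u \<in> mid_ball x y"
        then have "norm (midpoint x y - u) < norm (x - y) / 2" by (simp add: mid_ball_def dist_norm)
        moreover have "norm (x - y) / 2 < R + 2" using xy by (simp add: d_def)
        moreover have "norm u \<le> norm (midpoint x y) + norm (midpoint x y - u)"
          using norm_triangle_sub[of u "midpoint x y"] by (simp add: norm_minus_commute)
        ultimately show "u \<in> D" using m by (simp add: D_def d_def)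
      qed
      then show ?thesis using xy by simp
    qed
    let ?I = "\<integral>\<^sup>+x. ennreal (\<bar>v x\<bar> powr p) \<partial>?M"
    have v0': "AE x in ?M. x \<notin> \<Omega> \<longrightarrow> v x = 0" using v0 by (simp add: AE_weight_measure_iff[OF w])
    have I: "(\<integral>\<^sup>+x\<in>ball 0 R. ennreal (\<bar>v x\<bar> powr p) \<partial>?M) = ?I"
    proof (rule nn_integral_cong_AE, rule AE_mp[OF v0'], intro AE_I2 impI)
      fix x assume "x \<notin> \<Omega> \<longrightarrow> v x = 0"
      then show "ennreal (\<bar>v x\<bar> powr p) * indicator (ball 0 R) x = ennreal (\<bar>v x\<bar> powr p)"
        using R(2) by (cases "x \<in> ball 0 R") auto
    qed
    have "(\<integral>\<^sup>+y\<in>ball c 1. (\<integral>\<^sup>+x\<in>ball 0 R. ennreal (\<bar>v x - v y\<bar> powr p) \<partial>?M) \<partial>?M)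
       = (\<integral>\<^sup>+y\<in>ball c 1. ?I \<partial>?M)"
    proof (rule nn_integral_cong_AE, rule AE_mp[OF v0'], intro AE_I2 impI)
      fix y assume "y \<notin> \<Omega> \<longrightarrow> v y = 0"
      then have "y \<in> ball c 1 \<Longrightarrow> v y = 0" using far by auto
      then show "(\<integral>\<^sup>+x\<in>ball 0 R. ennreal (\<bar>v x - v y\<bar> powr p) \<partial>?M) * indicator (ball c 1) y
         = ?I * indicator (ball c 1) y"
        by (cases "y \<in> ball c 1") (simp_all add: I)
    qed
    also have "\<dots> = ?I * ennreal (weight_mass w (ball c 1))"
      by (simp add: nn_integral_cmult_indicator emeasure_weight_measure_eq_weight_mass[OF w])
    finally have eq: "(\<integral>\<^sup>+y\<in>ball c 1. (\<integral>\<^sup>+x\<in>ball 0 R. ennreal (\<bar>v x - v y\<bar> powr p) \<partial>?M) \<partial>?M)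
       = ?I * ennreal (weight_mass w (ball c 1))" .
    have "ennreal (s * (1 - s)) * (\<Sum>z\<in>{()}. ennreal (lam / d powr (s * p) / weight_mass w D) *
       (\<integral>\<^sup>+y\<in>ball c 1. (\<integral>\<^sup>+x\<in>ball 0 R. ennreal (\<bar>v x - v y\<bar> powr p) \<partial>?M) \<partial>?M)) \<le> energy k s p v"
      using geo by (intro energy_lower_bound[OF w adm par v]) (auto simp: disjoint_family_on_def D_def)
    then have le: "ennreal (s * (1 - s)) * (ennreal (b) *
        (?I * ennreal (weight_mass w (ball c 1)))) \<le> energy k s p v"
      by (simp add: eq b_def)
    have "?I = ennreal (C * N) * ?I" using N by (simp add: C_def)
    also have "\<dots> = ennreal C * (ennreal (s * (1 - s)) * (ennreal (b) *
        (?I * ennreal (weight_mass w (ball c 1)))))"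
      unfolding N_def using AD b par \<open>0 \<le> C\<close> by (simp add: ennreal_mult mult_ac)
    also have "\<dots> \<le> ennreal C * energy k s p v" by (intro mult_left_mono le) simp
    finally show "?I \<le> ennreal C * energy k s p v" .
  qed
qed

section \<open>Comparison of masses for Muckenhoupt weights\<close>

text \<open>
The defining bound of \<^term>\<open>Ap p\<close> on one ball, freed from \<^typ>\<open>ennreal\<close> arithmetic. The mass \<open>\<sigma>\<close> of the
dual weight is finite since otherwise \<^term>\<open>Ap_const p w\<close> would be infinite.
\<close>

lemma Ap_dual_mass_bound:
  fixes w :: "'a::euclidean_space \<Rightarrow> real"
  assumes "w \<in> Ap p" "1 < p" "0 < r"
  obtains \<sigma> where "0 < \<sigma>"
    "(\<integral>\<^sup>+x\<in>ball c r. ennreal (w x powr (1 / (1 - p))) \<partial>lebesgue) = ennreal \<sigma>"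
    "weight_mass w (ball c r) * \<sigma> powr (p - 1)
      \<le> enn2real (Ap_const p w) * measure lebesgue (ball c r) powr p"
proof -
  let ?B = "ball c r"
  have w: "weight w" and K: "Ap_const p w < \<infinity>" using assms(1) by (auto simp: Ap_def)
  have [measurable]: "w \<in> borel_measurable lebesgue" by (rule weight_borel_measurable[OF w])
  define V where "V = measure lebesgue ?B"
  have V0: "0 < V" using content_ball_gt_0_iff[of c r] \<open>0 < r\<close> by (simp add: V_def)
  have Ve: "emeasure lebesgue ?B = ennreal V"
    unfolding V_def using emeasure_lebesgue_ball[of r c] \<open>0 < r\<close>
    by (intro emeasure_eq_ennreal_measure) simp
  define S where "S = (\<integral>\<^sup>+x\<in>?B. ennreal (w x powr (1 / (1 - p))) \<partial>lebesgue)"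
  define m where "m = weight_mass w ?B"
  have m0: "0 < m" unfolding m_def by (rule weight_mass_ball_pos[OF w \<open>0 < r\<close>])
  have "(\<integral>\<^sup>+x\<in>?B. ennreal (w x) \<partial>lebesgue) = ennreal m"
    using emeasure_weight_measure[OF w, of ?B] emeasure_weight_measure_eq_weight_mass[OF w, of ?B]
    by (simp add: m_def)
  then have avg: "ball_avg w c r = ennreal (m / V)"
    using V0 m0 by (simp add: ball_avg_def Ve divide_ennreal)
  have "ball_avg w c r * enn_powr (ball_avg (\<lambda>x. w x powr (1 / (1 - p))) c r) (p - 1) \<le> Ap_const p w"
    unfolding Ap_const_def using \<open>0 < r\<close> by (intro SUP_upper2[of "(c, r)"]) auto
  then have bnd: "ennreal (m / V) * enn_powr (S / ennreal V) (p - 1) \<le> Ap_const p w"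
    by (simp add: avg) (simp add: ball_avg_def S_def Ve)
  have Sfin: "S \<noteq> \<infinity>"
  proof
    assume "S = \<infinity>"
    then have "enn_powr (S / ennreal V) (p - 1) = \<infinity>"
      by (simp add: enn_powr_def ennreal_top_divide)
    then show False using bnd K m0 V0 by (simp add: ennreal_mult_top)
  qed
  have Spos: "0 < S"
  proof (rule ccontr)
    assume "\<not> 0 < S"
    moreover have [measurable]: "?B \<in> sets lebesgue" by simp
    moreover have "(\<lambda>x. ennreal (w x powr (1 / (1 - p))) * indicator ?B x) \<in> borel_measurable lebesgue"
      by measurable
    ultimately have "AE x in lebesgue. ennreal (w x powr (1 / (1 - p))) * indicator ?B x = 0"
      unfolding S_def by (subst nn_integral_0_iff_AE[symmetric]) auto
    moreover have "AE x in lebesgue. 0 < w x" using w by (simp add: weight_def)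
    ultimately have "AE x in lebesgue. x \<notin> ?B"
      by eventually_elim (auto simp: indicator_def split: if_splits)
    then have "?B \<in> null_sets lebesgue" by (subst AE_iff_null_sets) auto
    then have "emeasure lebesgue ?B = 0" by (rule null_setsD1)
    then show False using V0 by (simp add: Ve)
  qed
  define \<sigma> where "\<sigma> = enn2real S"
  have S: "S = ennreal \<sigma>" using Sfin by (simp add: \<sigma>_def less_top)
  have \<sigma>0: "0 < \<sigma>" using Spos S by simp
  have "m / V * (\<sigma> / V) powr (p - 1) \<le> enn2real (Ap_const p w)"
  proof -
    have "ennreal (m / V * (\<sigma> / V) powr (p - 1)) = ennreal (m / V) * ennreal ((\<sigma> / V) powr (p - 1))"
      using V0 m0 by (intro ennreal_mult) auto
    also have "\<dots> \<le> Ap_const p w"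
      using bnd \<sigma>0 V0 by (simp add: S divide_ennreal enn_powr_def)
    also have "Ap_const p w = ennreal (enn2real (Ap_const p w))" using K by (simp add: less_top)
    finally show ?thesis by (simp add: ennreal_le_iff)
  qed
  moreover have "V * V powr (p - 1) = V powr p"
    using V0 powr_add[of V 1 "p - 1"] by simp
  then have "m / V * (\<sigma> / V) powr (p - 1) = m * \<sigma> powr (p - 1) / V powr p"
    using \<sigma>0 V0 by (simp add: powr_divide)
  ultimately have "m * \<sigma> powr (p - 1) / V powr p \<le> enn2real (Ap_const p w)" by (simp only:)
  then have "m * \<sigma> powr (p - 1) \<le> enn2real (Ap_const p w) * V powr p"
    using V0 by (simp add: divide_le_eq)
  then show thesis using \<sigma>0 S by (intro that[of \<sigma>]) (auto simp: S_def m_def V_def)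
qed

text \<open>
Pointwise, \<open>1 \<le> w powr (1 / (1 - p)) / \<tau> + \<tau> powr (p - 1) * w\<close> for every \<open>\<tau> > 0\<close>. Integrating this over
\<open>E\<close> with \<open>\<tau>\<close> chosen so that the dual weight accounts for at most half of the measure of \<open>E\<close> bounds
\<open>\<mu> E\<close> from below, and the \<open>A\<^sub>p\<close> condition bounds \<open>\<mu>\<close> of the ball from above. Compared with Hoelder's
inequality this loses only the factor \<open>2 powr p\<close>.
\<close>

lemma Ap_ball_mass_le:
  fixes w :: "'a::euclidean_space \<Rightarrow> real"
  assumes Ap: "w \<in> Ap p" and p: "1 < p" and r: "0 < r"
    and E: "E \<in> sets lebesgue" "E \<subseteq> ball c r"
  shows "weight_mass w (ball c r) * measure lebesgue E powr p
    \<le> enn2real (Ap_const p w) * (2 * measure lebesgue (ball c r)) powr p * weight_mass w E"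
proof -
  let ?B = "ball c r"
  define e where "e = measure lebesgue E"
  define V where "V = measure lebesgue ?B"
  define K where "K = enn2real (Ap_const p w)"
  define q where "q = p - 1"
  have q: "0 < q" using p by (simp add: q_def)
  have w: "weight w" using Ap by (auto simp: Ap_def)
  have [measurable]: "w \<in> borel_measurable lebesgue" by (rule weight_borel_measurable[OF w])
  note E(1)[measurable]
  have Ebdd: "bounded E" using E(2) bounded_ball bounded_subset by blast
  obtain \<sigma> where \<sigma>: "0 < \<sigma>"
    "(\<integral>\<^sup>+x\<in>?B. ennreal (w x powr (1 / (1 - p))) \<partial>lebesgue) = ennreal \<sigma>"
    "weight_mass w ?B * \<sigma> powr q \<le> K * V powr p"
    using Ap_dual_mass_bound[OF Ap p r, of c] unfolding K_def V_def q_def by blast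
  have mE: "0 \<le> weight_mass w E" by (rule weight_mass_nonneg[OF w])
  show ?thesis
  proof (cases "e = 0")
    case True
    then show ?thesis using mE by (simp add: e_def[symmetric])
  next
    case False
    then have e0: "0 < e" by (simp add: e_def zero_less_measure_iff)
    define \<tau> where "\<tau> = 2 * \<sigma> / e"
    have \<tau>: "0 < \<tau>" using \<sigma> e0 by (simp add: \<tau>_def)
    have "emeasure lebesgue E \<le> emeasure lebesgue ?B" using E by (intro emeasure_mono) auto
    also have "\<dots> < \<infinity>" using emeasure_lebesgue_ball[of r c] r by simp
    finally have Ee: "emeasure lebesgue E = ennreal e"
      unfolding e_def by (intro emeasure_eq_ennreal_measure) (simp add: less_top)
    \<comment> \<open>Either the dual weight is at least \<open>\<tau>\<close>, or \<open>w\<close> is at least \<open>\<tau> powr - q\<close>; in both cases one summand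
       alone is at least \<open>1\<close>.\<close>
    have pw: "1 \<le> (1 / \<tau>) * w x powr (1 / (1 - p)) + \<tau> powr q * w x" if "0 < w x" for x
    proof (cases "\<tau> \<le> w x powr (1 / (1 - p))")
      case True
      then have "1 \<le> (1 / \<tau>) * w x powr (1 / (1 - p))" using \<tau> by (simp add: field_simps)
      then show ?thesis using that by (smt (verit) mult_nonneg_nonneg powr_ge_zero)
    next
      case False
      then have "(w x powr (1 / (1 - p))) powr (- q) \<ge> \<tau> powr (- q)"
        using q that \<tau> powr_mono2'[of "- q" "w x powr (1 / (1 - p))" \<tau>] by (simp add: not_le)
      moreover have "(w x powr (1 / (1 - p))) powr (- q) = w x"
        using that p by (simp add: powr_powr q_def)
      ultimately have "\<tau> powr q * \<tau> powr (- q) \<le> \<tau> powr q * w x" by (intro mult_left_mono) auto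
      then have "1 \<le> \<tau> powr q * w x" using \<tau> by (simp flip: powr_add)
      moreover have "0 \<le> (1 / \<tau>) * w x powr (1 / (1 - p))" using \<tau> by simp
      ultimately show ?thesis by linarith
    qed
    have wpos: "AE x in lebesgue. 0 < w x" using w by (simp add: weight_def)
    have "ennreal e = (\<integral>\<^sup>+x\<in>E. 1 \<partial>lebesgue)" by (simp add: Ee)
    also have "\<dots> \<le> (\<integral>\<^sup>+x. ennreal (1 / \<tau>) * (ennreal (w x powr (1 / (1 - p))) * indicator ?B x)
        + ennreal (\<tau> powr q) * (ennreal (w x) * indicator E x) \<partial>lebesgue)"
    proof (rule nn_integral_mono_AE, rule AE_mp[OF wpos], intro AE_I2 impI)
      fix x assume x: "0 < w x"
      have "1 \<le> ennreal (1 / \<tau>) * ennreal (w x powr (1 / (1 - p))) + ennreal (\<tau> powr q) * ennreal (w x)"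
        using ennreal_leI[OF pw[OF x]] x \<tau>
        by (simp add: ennreal_mult[symmetric] ennreal_plus[symmetric] del: ennreal_plus)
      then show "1 * indicator E x \<le> ennreal (1 / \<tau>) * (ennreal (w x powr (1 / (1 - p))) * indicator ?B x)
        + ennreal (\<tau> powr q) * (ennreal (w x) * indicator E x)"
        using E(2) by (auto simp: indicator_def)
    qed
    also have "\<dots> = ennreal (1 / \<tau>) * ennreal \<sigma> + ennreal (\<tau> powr q) * ennreal (weight_mass w E)"
    proof -
      have [measurable]: "?B \<in> sets lebesgue" by simp
      have "(\<integral>\<^sup>+x\<in>E. ennreal (w x) \<partial>lebesgue) = ennreal (weight_mass w E)"
        by (simp only: emeasure_weight_measure[OF w E(1), symmetric]
            emeasure_weight_measure_eq_weight_mass[OF w E(1) Ebdd])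
      then show ?thesis by (simp add: nn_integral_add nn_integral_cmult \<sigma>(2))
    qed
    also have "\<dots> = ennreal (\<sigma> / \<tau> + \<tau> powr q * weight_mass w E)"
      using \<tau> \<sigma>(1) mE by (simp add: ennreal_mult[symmetric] ennreal_plus[symmetric] del: ennreal_plus)
    finally have "e \<le> \<sigma> / \<tau> + \<tau> powr q * weight_mass w E"
      using \<tau> \<sigma>(1) mE by (subst (asm) ennreal_le_iff) auto
    moreover have "\<sigma> / \<tau> = e / 2" using \<sigma>(1) e0 by (simp add: \<tau>_def)
    ultimately have "e \<le> 2 * (2 * \<sigma> / e) powr q * weight_mass w E" by (simp add: \<tau>_def)
    also have "(2 * \<sigma> / e) powr q = 2 powr q * \<sigma> powr q / e powr q"
      using \<sigma>(1) e0 by (simp add: powr_divide powr_mult)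
    finally have "e * e powr q \<le> 2 * 2 powr q * \<sigma> powr q * weight_mass w E"
      using e0 by (simp add: field_simps)
    moreover have "a * a powr q = a powr p" if "0 < a" for a :: real
      using that powr_add[of a 1 q] by (simp add: q_def)
    ultimately have ep: "e powr p \<le> 2 powr p * \<sigma> powr q * weight_mass w E" using e0 by simp
    have "weight_mass w ?B * e powr p \<le> weight_mass w ?B * (2 powr p * \<sigma> powr q * weight_mass w E)"
      using ep weight_mass_nonneg[OF w] by (intro mult_left_mono) auto
    also have "\<dots> = (weight_mass w ?B * \<sigma> powr q) * (2 powr p * weight_mass w E)" by (simp add: mult_ac)
    also have "\<dots> \<le> (K * V powr p) * (2 powr p * weight_mass w E)"
      using \<sigma>(3) mE by (intro mult_right_mono) auto
    also have "\<dots> = K * (2 * V) powr p * weight_mass w E"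
      by (simp add: V_def powr_mult mult_ac)
    finally show ?thesis by (simp add: e_def V_def K_def)
  qed
qed

section \<open>A grid of cubes\<close>

definition grid_cell :: "real \<Rightarrow> int ^ 'n \<Rightarrow> (real ^ 'n) set" where
  "grid_cell h z = {x. \<forall>i. h * of_int (z $ i) \<le> x $ i \<and> x $ i < h * of_int (z $ i) + h}"

definition grid_corner :: "real \<Rightarrow> int ^ 'n \<Rightarrow> real ^ 'n" where
  "grid_corner h z = (\<chi> i. h * of_int (z $ i))"

text \<open>
The radius is twice the bound \<open>CARD('n) * h\<close> for the diameter of a cell, so that the ball also contains
every \<^term>\<open>mid_ball x y\<close> with \<open>x\<close> and \<open>y\<close> in the cell.
\<close>

definition grid_ball :: "real \<Rightarrow> int ^ 'n \<Rightarrow> (real ^ 'n) set" where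
  "grid_ball h z = ball (grid_corner h z) (2 * (real CARD('n) * h))"

lemma grid_cell_lebesgue [measurable]: "grid_cell h z \<in> sets lebesgue"
proof -
  have "grid_cell h z = (\<Inter>i. {x. h * of_int (z $ i) \<le> x $ i} \<inter> {x. x $ i < h * of_int (z $ i) + h})"
    by (auto simp: grid_cell_def)
  moreover have "{x. h * of_int (z $ i) \<le> x $ i} \<inter> {x. x $ i < h * of_int (z $ i) + h} \<in> sets borel" for i
    by (intro sets.Int borel_closed borel_open closed_Collect_le open_Collect_less continuous_intros)
  ultimately have "grid_cell h z \<in> sets borel" by auto
  then show ?thesis by simp
qed

lemma grid_cell_coordinate:
  assumes "0 < h" "x \<in> grid_cell h z"
  shows "z $ i = \<lfloor>x $ i / h\<rfloor>"
proof -
  have "of_int (z $ i) \<le> x $ i / h \<and> x $ i / h < of_int (z $ i) + 1"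
    using assms by (auto simp: grid_cell_def field_simps)
  then show ?thesis by linarith
qed

lemma disjoint_grid_cells:
  assumes "0 < h" "z \<noteq> z'"
  shows "grid_cell h z \<inter> grid_cell h z' = {}"
proof (rule ccontr)
  assume "grid_cell h z \<inter> grid_cell h z' \<noteq> {}"
  then obtain x where "x \<in> grid_cell h z" "x \<in> grid_cell h z'" by auto
  then have "z $ i = z' $ i" for i
    using grid_cell_coordinate[OF \<open>0 < h\<close>, of x z i] grid_cell_coordinate[OF \<open>0 < h\<close>, of x z' i] by simp
  then have "z = z'" by (simp add: vec_eq_iff)
  then show False using assms by simp
qed

lemma mem_grid_cell_floor:
  assumes "0 < h"
  shows "x \<in> grid_cell h (\<chi> i. \<lfloor>x $ i / h\<rfloor>)"
proof -
  have "h * of_int \<lfloor>x $ i / h\<rfloor> \<le> x $ i \<and> x $ i < h * of_int \<lfloor>x $ i / h\<rfloor> + h" for i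
  proof -
    have "h * of_int \<lfloor>x $ i / h\<rfloor> \<le> h * (x $ i / h)" using assms by (intro mult_left_mono) auto
    moreover have "h * (x $ i / h) < h * (of_int \<lfloor>x $ i / h\<rfloor> + 1)"
      using assms by (intro mult_strict_left_mono) linarith+
    ultimately show ?thesis using assms by (simp add: algebra_simps)
  qed
  then show ?thesis by (simp add: grid_cell_def)
qed

lemma finite_grid_cells_meeting_bounded:
  fixes S :: "(real ^ 'n) set"
  assumes "0 < h" "bounded S"
  shows "finite {z. grid_cell h z \<inter> S \<noteq> {}}"
proof -
  obtain R where R: "S \<subseteq> ball 0 R" using bounded_subset_ballD[OF \<open>bounded S\<close>] by blast
  let ?A = "{\<lfloor>- R / h\<rfloor> .. \<lfloor>R / h\<rfloor>}"
  have "{z. grid_cell h z \<inter> S \<noteq> {}} \<subseteq> vec_lambda ` (PiE (UNIV :: 'n set) (\<lambda>_. ?A))"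
  proof
    fix z assume "z \<in> {z. grid_cell h z \<inter> S \<noteq> {}}"
    then obtain x where x: "x \<in> grid_cell h z" "x \<in> S" by auto
    have "z $ i \<in> ?A" for i
    proof -
      have "\<bar>x $ i\<bar> \<le> R" using R x(2) component_le_norm_cart[of x i] by (force simp: subset_eq)
      then have "- R \<le> x $ i" "x $ i \<le> R" by auto
      then have "- R / h \<le> x $ i / h" "x $ i / h \<le> R / h"
        using \<open>0 < h\<close> by (intro divide_right_mono; simp)+
      then show ?thesis unfolding grid_cell_coordinate[OF \<open>0 < h\<close> x(1)]
        by (auto intro: floor_mono)
    qed
    then show "z \<in> vec_lambda ` (PiE (UNIV :: 'n set) (\<lambda>_. ?A))"
      by (intro image_eqI[of _ _ "vec_nth z"]) auto
  qed
  then show ?thesis by (rule finite_subset) (intro finite_imageI finite_PiE, auto)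
qed

lemma norm_le_card_mult:
  fixes x :: "real ^ 'n"
  assumes "\<And>i. \<bar>x $ i\<bar> \<le> b"
  shows "norm x \<le> real CARD('n) * b"
proof -
  have "norm x \<le> (\<Sum>i\<in>UNIV. \<bar>x $ i\<bar>)" by (rule norm_le_l1_cart)
  also have "\<dots> \<le> real CARD('n) * b" using sum_bounded_above[of UNIV "\<lambda>i. \<bar>x $ i\<bar>" b] assms by simp
  finally show ?thesis .
qed

lemma grid_cell_geometry:
  fixes z :: "int ^ 'n"
  assumes h: "0 < h" and x: "x \<in> grid_cell h z" and y: "y \<in> grid_cell h z"
  shows "norm (x - y) \<le> real CARD('n) * h" "x \<in> grid_ball h z" "mid_ball x y \<subseteq> grid_ball h z"
proof -
  let ?c = "grid_corner h z" and ?d = "real CARD('n) * h"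
  have d0: "0 < ?d" using h by simp
  have "\<bar>(x - y) $ i\<bar> \<le> h" for i
    using x y by (auto simp: grid_cell_def abs_le_iff) (smt (verit))+
  then show xy: "norm (x - y) \<le> ?d" by (rule norm_le_card_mult)
  have corner: "norm (u - ?c) \<le> ?d" if "u \<in> grid_cell h z" for u
    using that h by (intro norm_le_card_mult) (auto simp: grid_cell_def grid_corner_def abs_le_iff, smt (verit))
  from corner[OF x] d0 show "x \<in> grid_ball h z"
    by (simp add: grid_ball_def dist_norm norm_minus_commute)
  have "midpoint x y - ?c = (1 / 2) *\<^sub>R ((x - ?c) + (y - ?c))"
    by (simp add: midpoint_def vec_eq_iff field_simps)
  then have "2 * norm (midpoint x y - ?c) \<le> norm (x - ?c) + norm (y - ?c)"
    using norm_triangle_ineq[of "x - ?c" "y - ?c"] by simp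
  then have m: "norm (midpoint x y - ?c) \<le> ?d" using corner[OF x] corner[OF y] by linarith
  show "mid_ball x y \<subseteq> grid_ball h z"
  proof
    fix u assume "u \<in> mid_ball x y"
    then have "norm (midpoint x y - u) < norm (x - y) / 2" by (simp add: mid_ball_def dist_norm)
    moreover have "norm (?c - u) \<le> norm (midpoint x y - ?c) + norm (midpoint x y - u)"
      using norm_triangle_ineq4[of "midpoint x y - u" "midpoint x y - ?c"] by simp
    ultimately show "u \<in> grid_ball h z" using xy m d0 by (simp add: grid_ball_def dist_norm)
  qed
qed

lemma grid_cell_subset_grid_ball: "0 < h \<Longrightarrow> grid_cell h z \<subseteq> grid_ball h z"
  by (intro subsetI) (rule grid_cell_geometry(2))

lemma bounded_grid_cell: "0 < h \<Longrightarrow> bounded (grid_cell h z)"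
  by (rule bounded_subset[OF _ grid_cell_subset_grid_ball]) (simp_all add: grid_ball_def)

lemma measure_grid_cell_ge:
  fixes z :: "int ^ 'n"
  assumes h: "0 < h"
  shows "h ^ CARD('n) \<le> measure lebesgue (grid_cell h z)"
proof -
  let ?c = "grid_corner h z" and ?e = "(\<chi> i. h) :: real ^ 'n"
  have sub: "box ?c (?c + ?e) \<subseteq> grid_cell h z"
    by (auto simp: mem_box_cart grid_cell_def grid_corner_def less_imp_le)
  have "emeasure lebesgue (grid_cell h z) \<le> emeasure lebesgue (grid_ball h z)"
    using grid_cell_subset_grid_ball[OF h, of z] by (intro emeasure_mono) (auto simp: grid_ball_def)
  also have "\<dots> < \<infinity>" unfolding grid_ball_def using h by (subst emeasure_lebesgue_ball) auto
  finally have fin: "emeasure lebesgue (grid_cell h z) < \<infinity>" .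
  have "h ^ CARD('n) = measure lebesgue (cbox ?c (?c + ?e))"
    using h by (simp add: content_cbox_if_cart interval_ne_empty_cart)
  also have "\<dots> = measure lebesgue (box ?c (?c + ?e))" by (simp add: measure_lborel_box_eq measure_lborel_cbox_eq)
  also have "\<dots> \<le> measure lebesgue (grid_cell h z)"
    using sub fin by (intro measure_mono_fmeasurable) (auto simp: fmeasurable_def)
  finally show ?thesis .
qed

text \<open>
The constant is uniform in the mesh \<open>h\<close> because the volumes of a cell and of its ball have a fixed
ratio.
\<close>

lemma Ap_grid_ball_mass_le:
  fixes w :: "real ^ 'n \<Rightarrow> real"
  assumes Ap: "w \<in> Ap p" and p: "1 < p"
  obtains C where "0 \<le> C"
    "\<And>h z. 0 < h \<Longrightarrow> weight_mass w (grid_ball h z) \<le> C * weight_mass w (grid_cell h z)"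
proof -
  have w: "weight w" using Ap by (auto simp: Ap_def)
  define n where "n = CARD('n)"
  define K where "K = enn2real (Ap_const p w)"
  define u where "u = unit_ball_vol (real n) * (2 * real n) ^ n"
  have u0: "0 \<le> u" by (simp add: u_def)
  have K0: "0 \<le> K" by (simp add: K_def)
  show thesis
  proof (rule that[of "K * (2 * u) powr p"])
    show "0 \<le> K * (2 * u) powr p" using K0 by simp
    fix h :: real and z :: "int ^ 'n" assume h: "0 < h"
    let ?m = "weight_mass w (grid_ball h z)" and ?mc = "weight_mass w (grid_cell h z)"
    let ?e = "measure lebesgue (grid_cell h z)"
    have r: "0 < 2 * (real n * h)" using h by (simp add: n_def)
    have V: "measure lebesgue (grid_ball h z) = u * h ^ n"
      using content_ball[of "2 * (real n * h)" "grid_corner h z"] r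
      by (simp add: grid_ball_def n_def u_def power_mult_distrib mult_ac)
    have "?m * (h ^ n) powr p \<le> ?m * ?e powr p"
      using measure_grid_cell_ge[OF h, of z] h p weight_mass_nonneg[OF w]
      by (intro mult_left_mono powr_mono2) (auto simp: n_def)
    also have "\<dots> \<le> K * (2 * (u * h ^ n)) powr p * ?mc"
    proof -
      have "grid_cell h z \<subseteq> ball (grid_corner h z) (2 * (real n * h))"
        using grid_cell_subset_grid_ball[OF h] by (simp only: grid_ball_def n_def)
      from Ap_ball_mass_le[OF Ap p r grid_cell_lebesgue this] show ?thesis
        unfolding K_def V[symmetric] by (simp only: grid_ball_def n_def)
    qed
    also have "(2 * (u * h ^ n)) powr p = (2 * u) powr p * (h ^ n) powr p"
      using h u0 by (simp add: powr_mult mult_ac)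
    finally have "?m * (h ^ n) powr p \<le> (K * (2 * u) powr p * ?mc) * (h ^ n) powr p" by (simp add: mult_ac)
    then show "?m \<le> K * (2 * u) powr p * ?mc" using h by (subst (asm) mult_le_cancel_right_pos) auto
  qed
qed

lemma emeasure_grid_cell:
  assumes "weight w" "0 < h"
  shows "emeasure (weight_measure w) (grid_cell h z) = ennreal (weight_mass w (grid_cell h z))"
  using assms by (intro emeasure_weight_measure_eq_weight_mass grid_cell_lebesgue bounded_grid_cell)

lemma weight_mass_grid_cell_pos:
  fixes w :: "real ^ 'n \<Rightarrow> real"
  assumes w: "weight w" and h: "0 < h"
  shows "0 < weight_mass w (grid_cell h z)"
proof -
  have "0 < h ^ CARD('n)" using h by simp
  then have "0 < measure lebesgue (grid_cell h z)" using measure_grid_cell_ge[OF h, of z] by linarith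
  then have "0 < emeasure lebesgue (grid_cell h z)" by (auto simp: measure_def zero_less_iff_neq_zero)
  then have "0 < ennreal (weight_mass w (grid_cell h z))"
    using emeasure_weight_measure_pos[OF w grid_cell_lebesgue] emeasure_grid_cell[OF w h] by metis
  then show ?thesis by simp
qed

section \<open>Approximation by step functions at bounded energy\<close>

text \<open>
The double integral is an average over \<open>y\<close>, and not all values can exceed their average. Without the
slack \<open>\<eta>\<close> one would have to discuss when a strict inequality survives integration.
\<close>

lemma exists_value_with_small_oscillation:
  fixes v :: "'a \<Rightarrow> real" and m \<eta> p :: real
  assumes Q: "Q \<in> sets M" and m: "emeasure M Q = ennreal m" "0 < m" and \<eta>: "0 < \<eta>"
  shows "\<exists>a. ennreal m * (\<integral>\<^sup>+x\<in>Q. ennreal (\<bar>v x - a\<bar> powr p) \<partial>M)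
      \<le> (\<integral>\<^sup>+y\<in>Q. (\<integral>\<^sup>+x\<in>Q. ennreal (\<bar>v x - v y\<bar> powr p) \<partial>M) \<partial>M) + ennreal \<eta>"
proof -
  define f where "f y = (\<integral>\<^sup>+x\<in>Q. ennreal (\<bar>v x - v y\<bar> powr p) \<partial>M)" for y
  define J where "J = (\<integral>\<^sup>+y\<in>Q. f y \<partial>M)"
  have "\<exists>y. ennreal m * f y \<le> J + ennreal \<eta>"
  proof (rule ccontr)
    assume neg: "\<nexists>y. ennreal m * f y \<le> J + ennreal \<eta>"
    then have lt: "J + ennreal \<eta> < ennreal m * f y" for y by (simp add: not_le)
    then have "J \<noteq> \<infinity>" using neg by auto
    then obtain t where t: "J = ennreal t" "0 \<le> t" by (cases J) auto
    have le: "ennreal ((t + \<eta>) / m) \<le> f y" for y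
    proof -
      have "ennreal (1 / m) * (J + ennreal \<eta>) \<le> ennreal (1 / m) * (ennreal m * f y)"
        using lt[of y] by (intro mult_left_mono) auto
      moreover have "ennreal (1 / m) * (ennreal m * f y) = f y"
        using m(2) by (simp add: mult.assoc[symmetric] ennreal_mult[symmetric])
      moreover have "ennreal (1 / m) * (J + ennreal \<eta>) = ennreal ((t + \<eta>) / m)"
        using m(2) t \<eta> by (simp add: ennreal_mult[symmetric] ennreal_plus[symmetric] del: ennreal_plus)
      ultimately show ?thesis by simp
    qed
    have "ennreal (t + \<eta>) = ennreal ((t + \<eta>) / m) * ennreal m"
      using m(2) t \<eta> by (simp add: ennreal_mult[symmetric])
    also have "\<dots> = (\<integral>\<^sup>+y\<in>Q. ennreal ((t + \<eta>) / m) \<partial>M)"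
      using Q by (simp add: nn_integral_cmult_indicator m(1))
    also have "\<dots> \<le> J" unfolding J_def by (intro nn_integral_mono mult_right_mono le) simp
    finally show False using t \<eta> by (simp add: ennreal_le_iff)
  qed
  then show ?thesis unfolding J_def f_def by blast
qed

text \<open>
With \<open>d = CARD('n) * h\<close>, the cell estimates add up to at most \<open>A * d powr (s * p)\<close>, where \<open>A\<close> depends on
the energy bound \<open>T\<close> but not on \<open>h\<close>. The mesh is chosen to make this at most \<open>\<delta> / 2\<close>; the other half of
\<open>\<delta>\<close> pays for the slack in choosing the values \<open>a z\<close>.
\<close>

lemma energy_bounded_near_step_functions:
  fixes w :: "real ^ 'n \<Rightarrow> real"
  assumes Ap: "w \<in> Ap p" and p: "1 < p" and adm: "admissible_kernel lam Lam w k"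
    and s: "0 < s" "s < 1" and lam: "0 < lam" and bdd: "bounded \<Omega>" and T: "0 \<le> T" and \<delta>: "0 < \<delta>"
  obtains Z :: "(int ^ 'n) set" and h where "finite Z" "0 < h" "\<Omega> \<subseteq> (\<Union>z\<in>Z. grid_cell h z)"
    "\<And>v. v \<in> borel_measurable lebesgue \<Longrightarrow> energy k s p v \<le> ennreal T \<Longrightarrow>
      \<exists>a. (\<Sum>z\<in>Z. \<integral>\<^sup>+x\<in>grid_cell h z. ennreal (\<bar>v x - a z\<bar> powr p) \<partial>weight_measure w) \<le> ennreal \<delta>"
proof -
  let ?M = "weight_measure w"
  have w: "weight w" using Ap by (auto simp: Ap_def)
  obtain C where C: "0 \<le> C"
    "\<And>h z. 0 < h \<Longrightarrow> weight_mass w (grid_ball h z) \<le> C * weight_mass w (grid_cell h z)"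
    using Ap_grid_ball_mass_le[OF Ap p] by blast
  define A where "A = C * T / (lam * (s * (1 - s)))"
  have A0: "0 \<le> A" using C T lam s by (simp add: A_def)
  define d where "d = (\<delta> / 2 / (A + 1)) powr (1 / (s * p))"
  have base: "0 < \<delta> / 2 / (A + 1)" using \<delta> A0 by simp
  have d0: "0 < d" using base unfolding d_def by (simp only: powr_gt_zero)
  have dsp: "d powr (s * p) = \<delta> / 2 / (A + 1)"
    using base s p \<delta> A0 by (simp add: d_def powr_powr del: divide_divide_eq_left)
  define h where "h = d / real CARD('n)"
  have h0: "0 < h" using d0 by (simp add: h_def)
  have hd: "real CARD('n) * h = d" by (simp add: h_def)
  define Z where "Z = {z. grid_cell h z \<inter> \<Omega> \<noteq> {}}"
  have fin: "finite Z" unfolding Z_def by (rule finite_grid_cells_meeting_bounded[OF h0 bdd])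
  have cover: "\<Omega> \<subseteq> (\<Union>z\<in>Z. grid_cell h z)"
    using mem_grid_cell_floor[OF h0] by (auto simp: Z_def)
  define m where "m z = weight_mass w (grid_cell h z)" for z
  define b where "b z = lam / d powr (s * p) / weight_mass w (grid_ball h z)" for z
  have mM: "emeasure ?M (grid_cell h z) = ennreal (m z)" for z
    unfolding m_def by (rule emeasure_grid_cell[OF w h0])
  have m0: "0 < m z" for z unfolding m_def by (rule weight_mass_grid_cell_pos[OF w h0])
  have gb: "0 < weight_mass w (grid_ball h z)" for z
    unfolding grid_ball_def using h0 by (intro weight_mass_ball_pos[OF w]) simp
  have b0: "0 < b z" for z using lam d0 gb by (simp add: b_def)
  have mb: "1 / m z \<le> C * d powr (s * p) / lam * b z" for z
  proof -
    have "C * d powr (s * p) / lam * b z = C / weight_mass w (grid_ball h z)"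
      using lam d0 by (simp add: b_def)
    moreover have "1 / m z \<le> C / weight_mass w (grid_ball h z)"
      using C(2)[OF h0, of z] m0[of z] gb[of z] by (simp add: m_def field_simps)
    ultimately show ?thesis by simp
  qed
  show thesis
  proof (rule that[OF fin h0 cover])
    fix v :: "real ^ 'n \<Rightarrow> real"
    assume v: "v \<in> borel_measurable lebesgue" and en: "energy k s p v \<le> ennreal T"
    define J where "J z = (\<integral>\<^sup>+y\<in>grid_cell h z. (\<integral>\<^sup>+x\<in>grid_cell h z. ennreal (\<bar>v x - v y\<bar> powr p) \<partial>?M) \<partial>?M)" for z
    define \<eta> where "\<eta> = \<delta> / (2 * (real (card Z) + 1))"
    have \<eta>: "0 < \<eta>" using \<delta> by (simp add: \<eta>_def)
    define I where "I a z = (\<integral>\<^sup>+x\<in>grid_cell h z. ennreal (\<bar>v x - a\<bar> powr p) \<partial>?M)" for a z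
    have "\<exists>a. ennreal (m z) * I a z \<le> J z + ennreal (\<eta> * m z)" for z
      unfolding I_def J_def
      by (rule exists_value_with_small_oscillation) (use mM m0 \<eta> in auto)
    then obtain a where a: "\<And>z. ennreal (m z) * I (a z) z \<le> J z + ennreal (\<eta> * m z)" by metis
    have low: "ennreal (s * (1 - s)) * (\<Sum>z\<in>Z. ennreal (b z) * J z) \<le> energy k s p v"
      unfolding b_def J_def
    proof (rule energy_lower_bound[OF w adm s _ lam v fin])
      show "disjoint_family_on (\<lambda>z. grid_cell h z \<times> grid_cell h z) Z"
        unfolding disjoint_family_on_def
        using disjoint_grid_cells[OF h0, where 'a = 'n] by (simp add: Times_Int_Times)
      show "mid_ball x y \<subseteq> grid_ball h z" if "x \<in> grid_cell h z" "y \<in> grid_cell h z" for x y :: "real ^ 'n" and z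
        using that by (rule grid_cell_geometry(3)[OF h0])
      show "norm (x - y) \<le> d" if "x \<in> grid_cell h z" "y \<in> grid_cell h z" for x y :: "real ^ 'n" and z
        using grid_cell_geometry(1)[OF h0 that] by (simp only: hd)
    qed (use p in \<open>auto simp: grid_ball_def\<close>)
    have term_le: "I (a z) z \<le> ennreal (C * d powr (s * p) / lam) * (ennreal (b z) * J z) + ennreal \<eta>" for z
    proof -
      have "I (a z) z = ennreal (1 / m z) * (ennreal (m z) * I (a z) z)"
        using m0[of z] by (simp add: mult.assoc[symmetric] ennreal_mult[symmetric])
      also have "\<dots> \<le> ennreal (1 / m z) * (J z + ennreal (\<eta> * m z))" by (intro mult_left_mono a) simp
      also have "\<dots> = ennreal (1 / m z) * J z + ennreal \<eta>"
        using m0[of z] \<eta> by (simp add: distrib_left ennreal_mult[symmetric])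
      also have "\<dots> \<le> ennreal (C * d powr (s * p) / lam * b z) * J z + ennreal \<eta>"
        by (intro add_right_mono mult_right_mono ennreal_leI mb) simp
      also have "ennreal (C * d powr (s * p) / lam * b z) = ennreal (C * d powr (s * p) / lam) * ennreal (b z)"
        using C lam less_imp_le[OF b0] by (intro ennreal_mult) auto
      finally show ?thesis by (simp add: mult.assoc)
    qed
    have "(\<Sum>z\<in>Z. I (a z) z) \<le> (\<Sum>z\<in>Z. ennreal (C * d powr (s * p) / lam) * (ennreal (b z) * J z) + ennreal \<eta>)"
      by (intro sum_mono term_le)
    also have "\<dots> = ennreal (C * d powr (s * p) / lam) * (\<Sum>z\<in>Z. ennreal (b z) * J z) + of_nat (card Z) * ennreal \<eta>"
      by (simp add: sum.distrib sum_distrib_left)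
    also have "\<dots> \<le> ennreal (\<delta> / 2) + ennreal (\<delta> / 2)"
    proof (rule add_mono)
      let ?c = "C * d powr (s * p) / (lam * (s * (1 - s)))"
      have c0: "0 \<le> ?c" using C lam s by simp
      have "ennreal (C * d powr (s * p) / lam) * (\<Sum>z\<in>Z. ennreal (b z) * J z)
          = ennreal (?c * (s * (1 - s))) * (\<Sum>z\<in>Z. ennreal (b z) * J z)"
        using lam s by simp
      also have "\<dots> = ennreal ?c * (ennreal (s * (1 - s)) * (\<Sum>z\<in>Z. ennreal (b z) * J z))"
        using c0 s by (subst ennreal_mult) (auto simp: mult.assoc)
      also have "\<dots> \<le> ennreal ?c * ennreal T" by (intro mult_left_mono order_trans[OF low en]) simp
      also have "\<dots> = ennreal (?c * T)" using c0 T by (rule ennreal_mult[symmetric])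
      also have "?c * T = A * d powr (s * p)" by (simp add: A_def)
      also have "\<dots> = A / (A + 1) * (\<delta> / 2)" by (simp add: dsp)
      also have "\<dots> \<le> 1 * (\<delta> / 2)" using A0 \<delta> by (intro mult_right_mono) auto
      finally show "ennreal (C * d powr (s * p) / lam) * (\<Sum>z\<in>Z. ennreal (b z) * J z) \<le> ennreal (\<delta> / 2)"
        by (simp add: ennreal_leI)
      have "real (card Z) * \<eta> \<le> \<delta> / 2" using \<delta> by (simp add: \<eta>_def field_simps)
      then show "of_nat (card Z) * ennreal \<eta> \<le> ennreal (\<delta> / 2)"
        using \<eta> by (simp add: ennreal_of_nat_eq_real_of_nat ennreal_mult[symmetric] ennreal_leI)
    qed
    also have "\<dots> = ennreal \<delta>" using \<delta> by (simp add: ennreal_plus[symmetric] del: ennreal_plus)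
    finally show "\<exists>a. (\<Sum>z\<in>Z. \<integral>\<^sup>+x\<in>grid_cell h z. ennreal (\<bar>v x - a z\<bar> powr p) \<partial>?M) \<le> ennreal \<delta>"
      unfolding I_def by blast
  qed
qed

section \<open>Relative compactness in spaces of p-integrable functions\<close>

text \<open>
A simple substitute for Minkowski's inequality that works for every positive exponent: the left-hand
side is at most \<open>(3 * m) powr p\<close> for the largest term \<open>m\<close>.
\<close>

lemma powr_abs_diff3_le:
  fixes a b c d :: real
  assumes "0 < p"
  shows "\<bar>a - b\<bar> powr p \<le> 3 powr p * (\<bar>a - c\<bar> powr p + \<bar>c - d\<bar> powr p + \<bar>b - d\<bar> powr p)"
proof -
  define m where "m = Max {\<bar>a - c\<bar>, \<bar>c - d\<bar>, \<bar>b - d\<bar>}"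
  have m: "m \<in> {\<bar>a - c\<bar>, \<bar>c - d\<bar>, \<bar>b - d\<bar>}" unfolding m_def by (rule Max_in) auto
  have le: "\<bar>a - c\<bar> \<le> m" "\<bar>c - d\<bar> \<le> m" "\<bar>b - d\<bar> \<le> m" unfolding m_def by (auto intro: Max_ge)
  have "\<bar>a - b\<bar> \<le> 3 * m" using le by linarith
  then have "\<bar>a - b\<bar> powr p \<le> (3 * m) powr p" using assms by (intro powr_mono2) auto
  also have "\<dots> = 3 powr p * m powr p" using le by (subst powr_mult) auto
  also have "m powr p \<le> \<bar>a - c\<bar> powr p + \<bar>c - d\<bar> powr p + \<bar>b - d\<bar> powr p"
    using m by auto
  finally show ?thesis by simp
qed

lemma powr_abs_le_diff2:
  fixes a b :: real
  assumes "0 < p"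
  shows "\<bar>a\<bar> powr p \<le> 3 powr p * (\<bar>b\<bar> powr p + \<bar>b - a\<bar> powr p)"
proof -
  have "\<bar>0 - a\<bar> powr p \<le> 3 powr p * (\<bar>0 - b\<bar> powr p + \<bar>b - a\<bar> powr p + \<bar>a - a\<bar> powr p)"
    using powr_abs_diff3_le[OF assms, of 0 a b a] .
  then show ?thesis by simp
qed

text \<open>
By the pigeonhole principle every sequence has, for each \<open>n\<close>, a subsequence with all mutual distances
at most \<open>1 / (n + 1)\<close>; the diagonal sequence eventually runs inside each of these.
\<close>

lemma Cauchy_subseq_of_finite_colourings:
  fixes dst :: "nat \<Rightarrow> nat \<Rightarrow> ennreal"
  assumes col: "\<And>\<delta>. (0::real) < \<delta> \<Longrightarrow> \<exists>\<kappa> :: nat \<Rightarrow> 'c. finite (range \<kappa>) \<and>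
      (\<forall>i j. \<kappa> i = \<kappa> j \<longrightarrow> dst i j \<le> ennreal \<delta>)"
  obtains r :: "nat \<Rightarrow> nat" where "strict_mono r"
    "\<And>\<delta>. 0 < \<delta> \<Longrightarrow> \<exists>N. \<forall>i\<ge>N. \<forall>j\<ge>N. dst (r i) (r j) \<le> ennreal \<delta>"
proof -
  define P where "P n s \<longleftrightarrow> (\<forall>i j. dst (s i) (s j) \<le> ennreal (inverse (real (Suc n))))"
    for n :: nat and s :: "nat \<Rightarrow> nat"
  interpret subseqs P
  proof
    fix n and s :: "nat \<Rightarrow> nat" assume "strict_mono s"
    obtain \<kappa> :: "nat \<Rightarrow> 'c" where fin: "finite (range \<kappa>)"
      and \<kappa>: "\<And>i j. \<kappa> i = \<kappa> j \<Longrightarrow> dst i j \<le> ennreal (inverse (real (Suc n)))"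
      using col[of "inverse (real (Suc n))"] by auto
    have "finite ((\<kappa> \<circ> s) ` UNIV)" by (rule finite_subset[OF _ fin]) auto
    from pigeonhole_infinite[OF infinite_UNIV_nat this]
    obtain i0 where inf: "infinite {i. \<kappa> (s i) = \<kappa> (s i0)}" by auto
    define t where "t = enumerate {i. \<kappa> (s i) = \<kappa> (s i0)}"
    have "strict_mono t" unfolding t_def by (rule strict_mono_enumerate[OF inf])
    moreover have "\<kappa> (s (t i)) = \<kappa> (s i0)" for i
      using enumerate_in_set[OF inf, of i] by (simp add: t_def)
    then have "dst (s (t i)) (s (t j)) \<le> ennreal (inverse (real (Suc n)))" for i j
      by (intro \<kappa>) simp
    then have "P n (s \<circ> t)" by (simp add: P_def)
    ultimately show "\<exists>r'. strict_mono r' \<and> P n (s \<circ> r')" by blast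
  qed
  show thesis
  proof (rule that[of diagseq])
    show "strict_mono diagseq" by (rule subseq_diagseq)
    fix \<delta> :: real assume "0 < \<delta>"
    then obtain n where n: "inverse (real (Suc n)) < \<delta>" using reals_Archimedean by blast
    have "P n (diagseq \<circ> ((+) (Suc n)))"
      by (rule diagseq_holds) (auto simp: P_def)
    then have P: "dst (diagseq (Suc n + i)) (diagseq (Suc n + j)) \<le> ennreal (inverse (real (Suc n)))" for i j
      by (simp add: P_def)
    have "dst (diagseq i) (diagseq j) \<le> ennreal \<delta>" if "Suc n \<le> i" "Suc n \<le> j" for i j
      using order_trans[OF P[of "i - Suc n" "j - Suc n"] ennreal_leI[OF less_imp_le[OF n]]] that by simp
    then show "\<exists>N. \<forall>i\<ge>N. \<forall>j\<ge>N. dst (diagseq i) (diagseq j) \<le> ennreal \<delta>" by blast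
  qed
qed

lemma tendsto_ennreal_0I:
  fixes f :: "nat \<Rightarrow> ennreal"
  assumes "\<And>\<epsilon>. 0 < \<epsilon> \<Longrightarrow> \<exists>n. \<forall>j\<ge>n. f j \<le> ennreal \<epsilon>"
  shows "f \<longlonglongrightarrow> 0"
proof (rule order_tendstoI)
  fix a :: ennreal assume "0 < a"
  then obtain \<epsilon> :: real where \<epsilon>: "0 < \<epsilon>" "ennreal \<epsilon> < a"
  proof (cases a)
    case (real t)
    then show ?thesis using \<open>0 < a\<close> that[of "t / 2"] by (simp add: ennreal_less_iff)
  next
    case top
    then show ?thesis using that[of 1] by simp
  qed
  then obtain n where "\<forall>j\<ge>n. f j \<le> ennreal \<epsilon>" using assms by blast
  then show "\<forall>\<^sub>F j in sequentially. f j < a"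
    using \<epsilon>(2) by (intro eventually_sequentiallyI[of n]) (auto intro: le_less_trans)
qed simp

text \<open>
The Riesz--Fischer argument without the triangle inequality in \<open>L\<^sup>p\<close>. Along a subsequence with
distances at most \<open>\<delta> k = 2 powr (- k - k * p)\<close> the sum \<open>G\<close> of the terms
\<open>2 powr (k * p) * \<bar>v (r (k + 1)) - v (r k)\<bar> powr p\<close> is integrable. Where \<open>G\<close> is finite the differences
decay geometrically, so the subsequence converges almost everywhere. Fatou's lemma then passes the
Cauchy estimates to the limit \<open>u\<close>, for the whole sequence.
\<close>

lemma Lp_Cauchy_imp_convergent:
  fixes v :: "nat \<Rightarrow> 'a \<Rightarrow> real"
  assumes v[measurable]: "\<And>j. v j \<in> borel_measurable M" and p: "0 < p"
    and cau: "\<And>\<delta>. 0 < \<delta> \<Longrightarrow> \<exists>N. \<forall>i\<ge>N. \<forall>j\<ge>N.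
      (\<integral>\<^sup>+x. ennreal (\<bar>v i x - v j x\<bar> powr p) \<partial>M) \<le> ennreal \<delta>"
  obtains u where "u \<in> borel_measurable M"
    "(\<lambda>j. \<integral>\<^sup>+x. ennreal (\<bar>v j x - u x\<bar> powr p) \<partial>M) \<longlonglongrightarrow> 0"
proof -
  define dst where "dst i j = (\<integral>\<^sup>+x. ennreal (\<bar>v i x - v j x\<bar> powr p) \<partial>M)" for i j
  define \<delta> where "\<delta> k = (1 / 2) ^ k * 2 powr (- (real k * p))" for k :: nat
  have "\<exists>N. \<forall>k. \<forall>i\<ge>N k. \<forall>j\<ge>N k. dst i j \<le> ennreal (\<delta> k)"
    using cau unfolding dst_def by (intro choice allI) (simp add: \<delta>_def)
  then obtain N where N: "\<And>k i j. N k \<le> i \<Longrightarrow> N k \<le> j \<Longrightarrow> dst i j \<le> ennreal (\<delta> k)" by blast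
  \<comment> \<open>The partial sums make \<open>r\<close> monotone, and the summand \<open>k\<close> makes it unbounded.\<close>
  define r where "r k = (\<Sum>l\<le>k. N l) + k" for k
  have rN: "N k \<le> r k" for k
  proof -
    have "N k \<le> (\<Sum>l\<le>k. N l)" by (rule member_le_sum) auto
    then show ?thesis by (simp add: r_def)
  qed
  have r_mono: "r k \<le> r (Suc k)" for k by (simp add: r_def)
  have r_ge: "k \<le> r k" for k by (simp add: r_def)
  have step: "dst (r (Suc k)) (r k) \<le> ennreal (\<delta> k)" for k
    using N[of k "r (Suc k)" "r k"] rN[of k] r_mono[of k] by simp
  let ?g = "\<lambda>k x. \<bar>v (r (Suc k)) x - v (r k) x\<bar>"
  define G where "G x = (\<Sum>k. ennreal (2 powr (real k * p) * ?g k x powr p))" for x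
  have Gm: "G \<in> borel_measurable M" unfolding G_def by measurable
  have "(\<integral>\<^sup>+x. G x \<partial>M)
    = (\<Sum>k. \<integral>\<^sup>+x. ennreal (2 powr (real k * p) * ?g k x powr p) \<partial>M)"
    unfolding G_def by (rule nn_integral_suminf) measurable
  also have "\<dots> \<le> (\<Sum>k. ennreal ((1 / 2) ^ k))"
  proof (intro suminf_le summableI)
    fix k
    have "(\<integral>\<^sup>+x. ennreal (2 powr (real k * p) * ?g k x powr p) \<partial>M)
        = ennreal (2 powr (real k * p)) * dst (r (Suc k)) (r k)"
      unfolding dst_def by (subst nn_integral_cmult[symmetric]) (auto simp: ennreal_mult)
    also have "\<dots> \<le> ennreal (2 powr (real k * p)) * ennreal (\<delta> k)" by (intro mult_left_mono step) simp
    also have "\<dots> = ennreal (2 powr (real k * p) * \<delta> k)" by (rule ennreal_mult[symmetric]) (auto simp: \<delta>_def)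
    also have "2 powr (real k * p) * \<delta> k = (1 / 2) ^ k"
      by (simp add: \<delta>_def mult.left_commute powr_minus)
    finally show "(\<integral>\<^sup>+x. ennreal (2 powr (real k * p) * ?g k x powr p) \<partial>M) \<le> ennreal ((1 / 2) ^ k)" .
  qed
  also have "\<dots> < \<infinity>"
    by (subst suminf_ennreal_eq[OF _ geometric_sums]) auto
  finally have "(\<integral>\<^sup>+x. G x \<partial>M) \<noteq> \<infinity>" by simp
  from nn_integral_noteq_infinite[OF Gm this] have "AE x in M. G x \<noteq> \<infinity>" .
  then have conv: "AE x in M. convergent (\<lambda>k. v (r k) x)"
  proof (rule AE_mp, intro AE_I2 impI)
    fix x assume fin: "G x \<noteq> \<infinity>"
    define A where "A = enn2real (G x)"
    have bound: "?g k x \<le> A powr (1 / p) * (1 / 2) ^ k" for k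
    proof -
      define h where "h k = ennreal (2 powr (real k * p) * ?g k x powr p)" for k
      have "sum h {k} \<le> suminf h" by (rule sum_le_suminf) auto
      then have "h k \<le> suminf h" by simp
      then have "ennreal (2 powr (real k * p) * ?g k x powr p) \<le> G x"
        unfolding G_def h_def .
      also have "\<dots> = ennreal A" using fin by (simp add: A_def less_top)
      finally have "2 powr (real k * p) * ?g k x powr p \<le> A"
        by (subst (asm) ennreal_le_iff) (auto simp: A_def)
      then have "(2 powr real k * ?g k x) powr p \<le> A" by (simp add: powr_mult powr_powr)
      then have "((2 powr real k * ?g k x) powr p) powr (1 / p) \<le> A powr (1 / p)"
        using p by (intro powr_mono2) auto
      then have "2 powr real k * ?g k x \<le> A powr (1 / p)" using p by (simp add: powr_powr)
      then show ?thesis by (simp add: powr_realpow field_simps power_divide)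
    qed
    have "summable (\<lambda>k. A powr (1 / p) * (1 / 2) ^ k)" by (intro summable_mult summable_geometric) simp
    then have "summable (\<lambda>k. v (r (Suc k)) x - v (r k) x)"
      by (rule summable_comparison_test'[where N = 0]) (use bound in simp)
    then have "convergent (\<lambda>n. \<Sum>k<n. v (r (Suc k)) x - v (r k) x)" by (simp add: summable_iff_convergent)
    then have "convergent (\<lambda>n. v (r n) x - v (r 0) x)" by (simp add: sum_lessThan_telescope[of "\<lambda>k. v (r k) x"])
    from convergent_add[OF this convergent_const[of "v (r 0) x"]] show "convergent (\<lambda>k. v (r k) x)" by simp
  qed
  define u where "u x = lim (\<lambda>k. v (r k) x)" for x
  have um[measurable]: "u \<in> borel_measurable M" unfolding u_def by measurable
  have lim: "AE x in M. (\<lambda>k. v (r k) x) \<longlonglongrightarrow> u x"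
    using conv by eventually_elim (simp add: u_def convergent_LIMSEQ_iff)
  \<comment> \<open>Fatou's lemma along the almost everywhere convergent subsequence.\<close>
  have fatou: "(\<integral>\<^sup>+x. ennreal (\<bar>v j x - u x\<bar> powr p) \<partial>M) \<le> ennreal \<epsilon>"
    if j: "n \<le> j" and n: "\<And>i j. n \<le> i \<Longrightarrow> n \<le> j \<Longrightarrow> dst i j \<le> ennreal \<epsilon>" for j n \<epsilon>
  proof -
    have "(\<integral>\<^sup>+x. ennreal (\<bar>v j x - u x\<bar> powr p) \<partial>M)
       = (\<integral>\<^sup>+x. liminf (\<lambda>k. ennreal (\<bar>v j x - v (r k) x\<bar> powr p)) \<partial>M)"
    proof (rule nn_integral_cong_AE, rule AE_mp[OF lim], intro AE_I2 impI)
      fix x assume "(\<lambda>k. v (r k) x) \<longlonglongrightarrow> u x"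
      then have "(\<lambda>k. ennreal (\<bar>v j x - v (r k) x\<bar> powr p)) \<longlonglongrightarrow> ennreal (\<bar>v j x - u x\<bar> powr p)"
        using p by (intro tendsto_ennrealI tendsto_powr' tendsto_intros) auto
      then show "ennreal (\<bar>v j x - u x\<bar> powr p) = liminf (\<lambda>k. ennreal (\<bar>v j x - v (r k) x\<bar> powr p))"
        by (rule lim_imp_Liminf[OF trivial_limit_sequentially, symmetric])
    qed
    also have "\<dots> \<le> liminf (\<lambda>k. \<integral>\<^sup>+x. ennreal (\<bar>v j x - v (r k) x\<bar> powr p) \<partial>M)"
      by (rule nn_integral_liminf) measurable
    also have "\<dots> \<le> ennreal \<epsilon>"
    proof (rule Liminf_le[OF trivial_limit_sequentially])
      have "dst j (r k) \<le> ennreal \<epsilon>" if "n \<le> k" for k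
        using n[OF j, of "r k"] that r_ge[of k] by simp
      then show "\<forall>\<^sub>F k in sequentially. (\<integral>\<^sup>+x. ennreal (\<bar>v j x - v (r k) x\<bar> powr p) \<partial>M) \<le> ennreal \<epsilon>"
        unfolding dst_def by (intro eventually_sequentiallyI[of n]) auto
    qed
    finally show ?thesis .
  qed
  have "(\<lambda>j. \<integral>\<^sup>+x. ennreal (\<bar>v j x - u x\<bar> powr p) \<partial>M) \<longlonglongrightarrow> 0"
  proof (rule tendsto_ennreal_0I)
    fix \<epsilon> :: real assume "0 < \<epsilon>"
    then obtain n where "\<forall>i\<ge>n. \<forall>j\<ge>n. dst i j \<le> ennreal \<epsilon>" using cau unfolding dst_def by blast
    then show "\<exists>n. \<forall>j\<ge>n. (\<integral>\<^sup>+x. ennreal (\<bar>v j x - u x\<bar> powr p) \<partial>M) \<le> ennreal \<epsilon>"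
      using fatou by blast
  qed
  then show thesis by (rule that[OF um])
qed

text \<open>
The colour of \<open>v j\<close> records, cell by cell, the value \<open>a j z\<close> of an approximating step function rounded
to a multiple of \<open>\<eta>\<close>. Only finitely many colours occur because \<open>a j z\<close> is bounded by means of the norm
of \<open>v j\<close>. For two functions of the same colour, the two approximation errors and the difference of
the step functions contribute at most \<open>\<delta>\<close> each, up to the factor from \<open>powr_abs_diff3_le\<close>.
\<close>

lemma finite_colouring_of_step_approximable:
  fixes v :: "nat \<Rightarrow> 'a \<Rightarrow> real" and Q :: "'z \<Rightarrow> 'a set" and m :: "'z \<Rightarrow> real"
  assumes v[measurable]: "\<And>j. v j \<in> borel_measurable M" and p: "0 < p"
    and fin: "finite Z" and Q: "\<And>z. z \<in> Z \<Longrightarrow> Q z \<in> sets M"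
    and m: "\<And>z. z \<in> Z \<Longrightarrow> emeasure M (Q z) = ennreal (m z)" "\<And>z. z \<in> Z \<Longrightarrow> 0 < m z"
    and zero: "\<And>j. AE x in M. x \<notin> (\<Union>z\<in>Z. Q z) \<longrightarrow> v j x = 0"
    and B: "0 \<le> B" "\<And>j. (\<integral>\<^sup>+x. ennreal (\<bar>v j x\<bar> powr p) \<partial>M) \<le> ennreal B" and \<delta>: "0 < \<delta>"
    and app: "\<And>j. \<exists>a. (\<Sum>z\<in>Z. \<integral>\<^sup>+x\<in>Q z. ennreal (\<bar>v j x - a z\<bar> powr p) \<partial>M) \<le> ennreal \<delta>"
  shows "\<exists>\<kappa> :: nat \<Rightarrow> 'z \<Rightarrow> int. finite (range \<kappa>) \<and>
      (\<forall>i j. \<kappa> i = \<kappa> j \<longrightarrow> (\<integral>\<^sup>+x. ennreal (\<bar>v i x - v j x\<bar> powr p) \<partial>M) \<le> ennreal (3 powr p * (3 * \<delta>)))"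
proof -
  obtain a where a: "\<And>j. (\<Sum>z\<in>Z. \<integral>\<^sup>+x\<in>Q z. ennreal (\<bar>v j x - a j z\<bar> powr p) \<partial>M) \<le> ennreal \<delta>"
  proof -
    have "\<forall>j. \<exists>a. (\<Sum>z\<in>Z. \<integral>\<^sup>+x\<in>Q z. ennreal (\<bar>v j x - a z\<bar> powr p) \<partial>M) \<le> ennreal \<delta>"
      using app by blast
    from choice[OF this] that show thesis by blast
  qed
  have m_sum: "0 \<le> sum m Z" using m(2) by (intro sum_nonneg) (auto intro: less_imp_le)
  define A where "A z = (3 powr p * (B + \<delta>) / m z) powr (1 / p)" for z
  have bound: "\<bar>a j z\<bar> \<le> A z" if z: "z \<in> Z" for j z
  proof -
    note Q[OF z, measurable]
    have single: "(\<integral>\<^sup>+x\<in>Q z. ennreal (\<bar>v j x - a j z\<bar> powr p) \<partial>M) \<le> ennreal \<delta>"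
      using a[of j] member_le_sum[OF z _ fin, of "\<lambda>z. \<integral>\<^sup>+x\<in>Q z. ennreal (\<bar>v j x - a j z\<bar> powr p) \<partial>M"]
      by (auto intro: order_trans)
    have "ennreal (\<bar>a j z\<bar> powr p * m z) = (\<integral>\<^sup>+x\<in>Q z. ennreal (\<bar>a j z\<bar> powr p) \<partial>M)"
      using m[OF z] Q[OF z] by (simp add: nn_integral_cmult_indicator ennreal_mult)
    also have "\<dots> \<le> (\<integral>\<^sup>+x. ennreal (3 powr p) * (ennreal (\<bar>v j x\<bar> powr p)
        + ennreal (\<bar>v j x - a j z\<bar> powr p) * indicator (Q z) x) \<partial>M)"
    proof (rule nn_integral_mono)
      fix x
      show "ennreal (\<bar>a j z\<bar> powr p) * indicator (Q z) x \<le> ennreal (3 powr p) * (ennreal (\<bar>v j x\<bar> powr p)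
        + ennreal (\<bar>v j x - a j z\<bar> powr p) * indicator (Q z) x)"
        using ennreal_leI[OF powr_abs_le_diff2[OF p, of "a j z" "v j x"]]
        by (cases "x \<in> Q z") (simp_all add: ennreal_mult ennreal_plus)
    qed
    also have "\<dots> = ennreal (3 powr p) * ((\<integral>\<^sup>+x. ennreal (\<bar>v j x\<bar> powr p) \<partial>M)
        + (\<integral>\<^sup>+x\<in>Q z. ennreal (\<bar>v j x - a j z\<bar> powr p) \<partial>M))"
      by (subst nn_integral_cmult, measurable) (subst nn_integral_add, auto)
    also have "\<dots> \<le> ennreal (3 powr p) * (ennreal B + ennreal \<delta>)"
      by (intro mult_left_mono add_mono B(2) single) simp
    also have "\<dots> = ennreal (3 powr p * (B + \<delta>))" using B(1) \<delta> by (simp add: ennreal_mult)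
    finally have "\<bar>a j z\<bar> powr p * m z \<le> 3 powr p * (B + \<delta>)"
      using B(1) \<delta> by (subst (asm) ennreal_le_iff) auto
    then have "\<bar>a j z\<bar> powr p \<le> 3 powr p * (B + \<delta>) / m z" using m(2)[OF z] by (simp add: le_divide_eq)
    then have "(\<bar>a j z\<bar> powr p) powr (1 / p) \<le> A z" unfolding A_def using p by (intro powr_mono2) auto
    then show ?thesis using p by (simp add: powr_powr)
  qed
  \<comment> \<open>The \<open>+ 1\<close> only guards against \<open>sum m Z = 0\<close>, that is, an empty \<open>Z\<close>.\<close>
  define \<eta> where "\<eta> = (\<delta> / (sum m Z + 1)) powr (1 / p)"
  have \<eta>0: "0 < \<eta>" using \<delta> m_sum by (simp add: \<eta>_def)
  have \<eta>p: "\<eta> powr p * sum m Z \<le> \<delta>"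
  proof -
    have "\<eta> powr p = \<delta> / (sum m Z + 1)" using \<delta> m_sum p by (simp add: \<eta>_def powr_powr)
    then have "\<eta> powr p * sum m Z + \<eta> powr p = \<delta>" using m_sum by (simp add: field_simps)
    moreover have "0 \<le> \<eta> powr p" by simp
    ultimately show ?thesis by linarith
  qed
  define \<kappa> where "\<kappa> j = (\<lambda>z\<in>Z. \<lfloor>a j z / \<eta>\<rfloor>)" for j
  have "range \<kappa> \<subseteq> PiE Z (\<lambda>z. {\<lfloor>- A z / \<eta>\<rfloor> .. \<lfloor>A z / \<eta>\<rfloor>})"
  proof -
    have "\<lfloor>a j z / \<eta>\<rfloor> \<in> {\<lfloor>- A z / \<eta>\<rfloor> .. \<lfloor>A z / \<eta>\<rfloor>}" if "z \<in> Z" for j z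
    proof -
      have "- A z \<le> a j z" "a j z \<le> A z" using bound[OF that, of j] by auto
      then have "- A z / \<eta> \<le> a j z / \<eta>" "a j z / \<eta> \<le> A z / \<eta>"
        using \<eta>0 by (intro divide_right_mono; simp)+
      then show ?thesis by (auto intro: floor_mono)
    qed
    then show ?thesis by (auto simp: \<kappa>_def)
  qed
  then have "finite (range \<kappa>)" by (rule finite_subset) (intro finite_PiE fin, auto)
  moreover have "(\<integral>\<^sup>+x. ennreal (\<bar>v i x - v j x\<bar> powr p) \<partial>M) \<le> ennreal (3 powr p * (3 * \<delta>))"
    if eq: "\<kappa> i = \<kappa> j" for i j
  proof -
    have near: "\<bar>a i z - a j z\<bar> \<le> \<eta>" if z: "z \<in> Z" for z
    proof -
      have "\<lfloor>a i z / \<eta>\<rfloor> = \<lfloor>a j z / \<eta>\<rfloor>" using fun_cong[OF eq, of z] z by (simp add: \<kappa>_def)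
      then have "\<bar>a i z / \<eta> - a j z / \<eta>\<bar> \<le> 1" by linarith
      then have "\<bar>(a i z - a j z) / \<eta>\<bar> \<le> 1" by (simp add: diff_divide_distrib)
      then show ?thesis using \<eta>0 by (simp add: abs_divide)
    qed
    let ?f = "\<lambda>x. ennreal (\<bar>v i x - v j x\<bar> powr p)"
    let ?d = "\<lambda>l z x. ennreal (\<bar>v l x - a l z\<bar> powr p)"
    have cell: "(\<integral>\<^sup>+x\<in>Q z. ?f x \<partial>M) \<le> ennreal (3 powr p) *
        ((\<integral>\<^sup>+x\<in>Q z. ?d i z x \<partial>M) + ennreal (\<eta> powr p * m z) + (\<integral>\<^sup>+x\<in>Q z. ?d j z x \<partial>M))" if z: "z \<in> Z" for z
    proof -
      note Q[OF z, measurable]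
      have "(\<integral>\<^sup>+x\<in>Q z. ?f x \<partial>M) \<le> (\<integral>\<^sup>+x. ennreal (3 powr p) * (?d i z x * indicator (Q z) x
          + ennreal (\<eta> powr p) * indicator (Q z) x + ?d j z x * indicator (Q z) x) \<partial>M)"
      proof (rule nn_integral_mono)
        fix x
        have "\<bar>v i x - v j x\<bar> powr p \<le> 3 powr p * (\<bar>v i x - a i z\<bar> powr p + \<bar>a i z - a j z\<bar> powr p + \<bar>v j x - a j z\<bar> powr p)"
          by (rule powr_abs_diff3_le[OF p])
        also have "\<dots> \<le> 3 powr p * (\<bar>v i x - a i z\<bar> powr p + \<eta> powr p + \<bar>v j x - a j z\<bar> powr p)"
          using near[OF z] p by (intro mult_left_mono add_mono powr_mono2) auto
        finally have "?f x \<le> ennreal (3 powr p * (\<bar>v i x - a i z\<bar> powr p + \<eta> powr p + \<bar>v j x - a j z\<bar> powr p))"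
          by (rule ennreal_leI)
        then show "?f x * indicator (Q z) x \<le> ennreal (3 powr p) * (?d i z x * indicator (Q z) x
          + ennreal (\<eta> powr p) * indicator (Q z) x + ?d j z x * indicator (Q z) x)"
          by (cases "x \<in> Q z") (simp_all add: ennreal_mult ennreal_plus)
      qed
      also have "\<dots> = ennreal (3 powr p) *
        ((\<integral>\<^sup>+x\<in>Q z. ?d i z x \<partial>M) + ennreal (\<eta> powr p) * emeasure M (Q z) + (\<integral>\<^sup>+x\<in>Q z. ?d j z x \<partial>M))"
        using Q[OF z] by (simp add: nn_integral_cmult nn_integral_add nn_integral_cmult_indicator)
      finally show ?thesis using m[OF z] by (simp add: ennreal_mult)
    qed
    have "(\<integral>\<^sup>+x. ?f x \<partial>M) \<le> (\<integral>\<^sup>+x. (\<Sum>z\<in>Z. ?f x * indicator (Q z) x) \<partial>M)"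
    proof (rule nn_integral_mono_AE, rule AE_mp[OF zero[of i]], rule AE_mp[OF zero[of j]], intro AE_I2 impI)
      fix x assume 0: "x \<notin> (\<Union>z\<in>Z. Q z) \<longrightarrow> v j x = 0" "x \<notin> (\<Union>z\<in>Z. Q z) \<longrightarrow> v i x = 0"
      show "?f x \<le> (\<Sum>z\<in>Z. ?f x * indicator (Q z) x)"
      proof (cases "x \<in> (\<Union>z\<in>Z. Q z)")
        case True
        then obtain z where z: "z \<in> Z" "x \<in> Q z" by auto
        show ?thesis using member_le_sum[OF z(1) _ fin, of "\<lambda>z. ?f x * indicator (Q z) x"] z(2) by simp
      next
        case False
        then show ?thesis using 0 by simp
      qed
    qed
    also have "\<dots> = (\<Sum>z\<in>Z. \<integral>\<^sup>+x\<in>Q z. ?f x \<partial>M)"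
    proof (rule nn_integral_sum)
      fix z assume "z \<in> Z"
      note Q[OF this, measurable]
      show "(\<lambda>x. ?f x * indicator (Q z) x) \<in> borel_measurable M" by measurable
    qed
    also have "\<dots> \<le> (\<Sum>z\<in>Z. ennreal (3 powr p) *
        ((\<integral>\<^sup>+x\<in>Q z. ?d i z x \<partial>M) + ennreal (\<eta> powr p * m z) + (\<integral>\<^sup>+x\<in>Q z. ?d j z x \<partial>M)))"
      by (intro sum_mono cell)
    also have "\<dots> = ennreal (3 powr p) * ((\<Sum>z\<in>Z. \<integral>\<^sup>+x\<in>Q z. ?d i z x \<partial>M)
        + (\<Sum>z\<in>Z. ennreal (\<eta> powr p * m z)) + (\<Sum>z\<in>Z. \<integral>\<^sup>+x\<in>Q z. ?d j z x \<partial>M))"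
      by (simp add: sum_distrib_left[symmetric] sum.distrib)
    also have "(\<Sum>z\<in>Z. ennreal (\<eta> powr p * m z)) = ennreal (\<eta> powr p * sum m Z)"
      using m(2) by (subst sum_ennreal) (auto simp: sum_distrib_left less_imp_le)
    also have "ennreal (3 powr p) * ((\<Sum>z\<in>Z. \<integral>\<^sup>+x\<in>Q z. ?d i z x \<partial>M)
        + ennreal (\<eta> powr p * sum m Z) + (\<Sum>z\<in>Z. \<integral>\<^sup>+x\<in>Q z. ?d j z x \<partial>M))
      \<le> ennreal (3 powr p) * (ennreal \<delta> + ennreal \<delta> + ennreal \<delta>)"
      by (intro mult_left_mono add_mono a ennreal_leI \<eta>p) simp
    also have "\<dots> = ennreal (3 powr p * (3 * \<delta>))"
    proof -
      have "ennreal \<delta> + ennreal \<delta> + ennreal \<delta> = ennreal (3 * \<delta>)"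
        using \<delta> by (simp add: ennreal_plus[symmetric] del: ennreal_plus)
      then show ?thesis using \<delta> by (simp add: ennreal_mult)
    qed
    finally show ?thesis .
  qed
  ultimately show ?thesis by blast
qed

section \<open>The compact embedding\<close>

lemma enn_powr_mono: "0 \<le> a \<Longrightarrow> x \<le> y \<Longrightarrow> enn_powr x a \<le> enn_powr y a"
proof (cases "y = \<infinity>")
  case False
  assume a: "0 \<le> a" and le: "x \<le> y"
  then have "x \<noteq> \<infinity>" using False by (auto simp: top_unique)
  moreover have "enn2real x \<le> enn2real y" using le False by (intro enn2real_mono) (auto simp: less_top)
  ultimately show ?thesis using a False by (auto simp: enn_powr_def intro!: ennreal_leI powr_mono2)
qed (simp add: enn_powr_def)

lemma enn_powr_ennreal: "0 \<le> t \<Longrightarrow> enn_powr (ennreal t) a = ennreal (t powr a)"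
  by (simp add: enn_powr_def)

lemma enn_powr_less_top: "x < \<infinity> \<Longrightarrow> enn_powr x a < \<infinity>"
  by (simp add: enn_powr_def)

lemma enn_powr_cmult:
  assumes "0 \<le> C" "x < \<infinity>"
  shows "enn_powr (ennreal C * x) a = ennreal (C powr a) * enn_powr x a"
proof -
  obtain t where t: "x = ennreal t" "0 \<le> t" using assms(2) by (cases x) auto
  have "enn_powr (ennreal C * x) a = ennreal ((C * t) powr a)"
    using t assms(1) by (simp only: ennreal_mult[symmetric] enn_powr_ennreal mult_nonneg_nonneg)
  also have "(C * t) powr a = C powr a * t powr a" using t assms(1) by (simp only: powr_mult)
  also have "ennreal \<dots> = ennreal (C powr a) * enn_powr x a"
    using t by (simp only: enn_powr_ennreal) (simp add: ennreal_mult)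
  finally show ?thesis .
qed

text \<open>
The maximum with \<open>0\<close> is there because \<open>ennreal b = 0\<close> for negative \<open>b\<close>, while \<open>b powr p\<close> need not
vanish.
\<close>

lemma enn_powr_inverse_le_imp:
  assumes "0 < p" and le: "enn_powr x (1 / p) \<le> ennreal b"
  shows "x \<le> ennreal (max 0 b powr p)"
proof (cases x)
  case (real t)
  then have "ennreal (t powr (1 / p)) \<le> ennreal b" using le by (simp add: enn_powr_ennreal)
  also have "\<dots> \<le> ennreal (max 0 b)" by (intro ennreal_leI) simp
  finally have "ennreal (t powr (1 / p)) \<le> ennreal (max 0 b)" .
  then have "t powr (1 / p) \<le> max 0 b" by (subst (asm) ennreal_le_iff) auto
  then have "(t powr (1 / p)) powr p \<le> max 0 b powr p" using assms(1) by (intro powr_mono2) auto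
  then show ?thesis using real assms(1) by (simp add: powr_powr ennreal_leI)
next
  case top
  then show ?thesis using le by (simp add: enn_powr_def top_unique)
qed

lemma tendsto_enn_powr_0:
  assumes "f \<longlonglongrightarrow> 0" "0 < a"
  shows "(\<lambda>j. enn_powr (f j) a) \<longlonglongrightarrow> 0"
proof (rule tendsto_ennreal_0I)
  fix \<epsilon> :: real assume \<epsilon>: "0 < \<epsilon>"
  have "\<forall>\<^sub>F j in sequentially. f j < ennreal (\<epsilon> powr (1 / a))"
    using order_tendstoD(2)[OF assms(1), of "ennreal (\<epsilon> powr (1 / a))"] \<epsilon> by simp
  then obtain n where n: "\<And>j. n \<le> j \<Longrightarrow> f j < ennreal (\<epsilon> powr (1 / a))"
    by (auto simp: eventually_sequentially)
  have "enn_powr (f j) a \<le> ennreal \<epsilon>" if "n \<le> j" for j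
  proof -
    have "enn_powr (f j) a \<le> enn_powr (ennreal (\<epsilon> powr (1 / a))) a"
      using n[OF that] assms(2) by (intro enn_powr_mono) auto
    also have "\<dots> = ennreal \<epsilon>" using \<epsilon> assms(2) by (simp add: enn_powr_ennreal powr_powr)
    finally show ?thesis .
  qed
  then show "\<exists>n. \<forall>j\<ge>n. enn_powr (f j) a \<le> ennreal \<epsilon>" by blast
qed

lemma Lpw_norm_le:
  assumes w: "weight w" and "0 < p" and v: "v \<in> borel_measurable lebesgue"
  shows "Lpw_norm p w \<Omega> v \<le> enn_powr (\<integral>\<^sup>+x. ennreal (\<bar>v x\<bar> powr p) \<partial>weight_measure w) (1 / p)"
proof -
  have [measurable]: "w \<in> borel_measurable lebesgue" by (rule weight_borel_measurable[OF w])
  note v[measurable]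
  have wpos: "AE x in lebesgue. 0 < w x" using w by (simp add: weight_def)
  have "(\<integral>\<^sup>+x\<in>\<Omega>. ennreal (\<bar>v x\<bar> powr p * w x) \<partial>lebesgue)
      \<le> (\<integral>\<^sup>+x. ennreal (w x) * ennreal (\<bar>v x\<bar> powr p) \<partial>lebesgue)"
  proof (rule nn_integral_mono_AE, rule AE_mp[OF wpos], intro AE_I2 impI)
    fix x assume "0 < w x"
    then show "ennreal (\<bar>v x\<bar> powr p * w x) * indicator \<Omega> x \<le> ennreal (w x) * ennreal (\<bar>v x\<bar> powr p)"
      by (simp add: ennreal_mult[symmetric] indicator_def mult.commute)
  qed
  also have "\<dots> = (\<integral>\<^sup>+x. ennreal (\<bar>v x\<bar> powr p) \<partial>weight_measure w)"
    unfolding weight_measure_def by (rule nn_integral_density[symmetric]) measurable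
  finally show ?thesis unfolding Lpw_norm_def using \<open>0 < p\<close> by (intro enn_powr_mono) auto
qed


theorem theorem2p23:
  fixes \<Omega> :: "(real ^ 'n) set" and w :: "real ^ 'n \<Rightarrow> real"
    and k :: "real ^ 'n \<Rightarrow> real ^ 'n \<Rightarrow> real" and s p lam Lam :: real
  assumes "CARD('n) \<ge> 2"
    and "open \<Omega>" and "bounded \<Omega>"
    and "0 < s" and "s < 1" and "1 < p"
    and "w \<in> Ap p"
    and "0 < lam" and "lam \<le> Lam"
    and "admissible_kernel lam Lam w k"
  shows "compact_embedding (W0_space k s p \<Omega>) (W_norm k s p) (Lpw_space p w \<Omega>) (Lpw_norm p w \<Omega>)"
proof -
  let ?M = "weight_measure w"
  have w: "weight w" using \<open>w \<in> Ap p\<close> by (auto simp: Ap_def)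
  have p: "0 < p" using \<open>1 < p\<close> by simp
  obtain C where C: "0 \<le> C"
    "\<And>v. v \<in> borel_measurable lebesgue \<Longrightarrow> AE x in lebesgue. x \<notin> \<Omega> \<longrightarrow> v x = 0 \<Longrightarrow>
      (\<integral>\<^sup>+x. ennreal (\<bar>v x\<bar> powr p) \<partial>?M) \<le> ennreal C * energy k s p v"
    using friedrichs_inequality[OF w \<open>admissible_kernel lam Lam w k\<close> \<open>0 < s\<close> \<open>s < 1\<close> p \<open>0 < lam\<close> \<open>bounded \<Omega>\<close>]
    by blast
  have W0: "v \<in> borel_measurable lebesgue" "AE x in lebesgue. x \<notin> \<Omega> \<longrightarrow> v x = 0" "energy k s p v < \<infinity>"
    if "v \<in> W0_space k s p \<Omega>" for v
    using that by (auto simp: W0_space_def W_space_def intro: L1_loc_borel_measurable)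
  have mem: "v \<in> Lpw_space p w \<Omega>"
    if "v \<in> borel_measurable lebesgue" "(\<integral>\<^sup>+x. ennreal (\<bar>v x\<bar> powr p) \<partial>?M) < \<infinity>" for v
    unfolding Lpw_space_def
    using that order.strict_trans1[OF Lpw_norm_le[OF w p that(1)] enn_powr_less_top[OF that(2)]]
    by (auto intro: measurable_restrict_space1)
  have Cfin: "ennreal C * energy k s p v < \<infinity>" if "v \<in> W0_space k s p \<Omega>" for v
    using W0(3)[OF that] by (simp add: ennreal_mult_less_top)
  have "W0_space k s p \<Omega> \<subseteq> Lpw_space p w \<Omega>"
  proof
    fix v assume v: "v \<in> W0_space k s p \<Omega>"
    show "v \<in> Lpw_space p w \<Omega>"
      by (rule mem[OF W0(1)[OF v] order.strict_trans1[OF C(2)[OF W0(1,2)[OF v]] Cfin[OF v]]])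
  qed
  moreover have "Lpw_norm p w \<Omega> v \<le> ennreal (C powr (1 / p)) * W_norm k s p v"
    if v: "v \<in> W0_space k s p \<Omega>" for v
  proof -
    have "Lpw_norm p w \<Omega> v \<le> enn_powr (\<integral>\<^sup>+x. ennreal (\<bar>v x\<bar> powr p) \<partial>?M) (1 / p)"
      by (rule Lpw_norm_le[OF w p W0(1)[OF v]])
    also have "\<dots> \<le> enn_powr (ennreal C * energy k s p v) (1 / p)"
      using p by (intro enn_powr_mono C(2) W0[OF v]) auto
    also have "\<dots> = ennreal (C powr (1 / p)) * W_norm k s p v"
      unfolding W_norm_def by (rule enn_powr_cmult[OF C(1) W0(3)[OF v]])
    finally show ?thesis .
  qed
  moreover have "\<exists>u\<in>Lpw_space p w \<Omega>. \<exists>r. strict_mono r \<and>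
      (\<lambda>j. Lpw_norm p w \<Omega> (\<lambda>x. v (r j) x - u x)) \<longlonglongrightarrow> 0"
    if bounded_seq: "\<forall>j. v j \<in> W0_space k s p \<Omega> \<and> W_norm k s p (v j) \<le> ennreal b"
    for v :: "nat \<Rightarrow> real ^ 'n \<Rightarrow> real" and b :: real
  proof -
    define T where "T = max 0 b powr p"
    have T: "0 \<le> T" by (simp add: T_def)
    have vm: "v j \<in> borel_measurable lebesgue" for j using W0(1) bounded_seq by blast
    then have vM: "v j \<in> borel_measurable ?M" for j
      by (simp add: measurable_cong_sets[OF sets_weight_measure refl])
    have en: "energy k s p (v j) \<le> ennreal T" for j
      unfolding T_def using bounded_seq p by (intro enn_powr_inverse_le_imp) (auto simp: W_norm_def)
    have B: "(\<integral>\<^sup>+x. ennreal (\<bar>v j x\<bar> powr p) \<partial>?M) \<le> ennreal (C * T)" for j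
    proof -
      have "(\<integral>\<^sup>+x. ennreal (\<bar>v j x\<bar> powr p) \<partial>?M) \<le> ennreal C * energy k s p (v j)"
        using C(2) W0 bounded_seq by blast
      also have "\<dots> \<le> ennreal C * ennreal T" by (intro mult_left_mono en) simp
      finally show ?thesis using C(1) T by (simp add: ennreal_mult)
    qed
    have colouring: "\<exists>\<kappa> :: nat \<Rightarrow> int ^ 'n \<Rightarrow> int. finite (range \<kappa>) \<and>
        (\<forall>i j. \<kappa> i = \<kappa> j \<longrightarrow> (\<integral>\<^sup>+x. ennreal (\<bar>v i x - v j x\<bar> powr p) \<partial>?M) \<le> ennreal \<delta>)"
      if \<delta>: "0 < \<delta>" for \<delta> :: real
    proof -
      define \<delta>' where "\<delta>' = \<delta> / (3 powr p * 3)"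
      have \<delta>': "0 < \<delta>'" using \<delta> by (simp add: \<delta>'_def)
      have \<delta>eq: "3 powr p * (3 * \<delta>') = \<delta>" by (simp add: \<delta>'_def)
      obtain Z :: "(int ^ 'n) set" and h where Z: "finite Z" "0 < h" "\<Omega> \<subseteq> (\<Union>z\<in>Z. grid_cell h z)"
        "\<And>v. v \<in> borel_measurable lebesgue \<Longrightarrow> energy k s p v \<le> ennreal T \<Longrightarrow>
          \<exists>a. (\<Sum>z\<in>Z. \<integral>\<^sup>+x\<in>grid_cell h z. ennreal (\<bar>v x - a z\<bar> powr p) \<partial>?M) \<le> ennreal \<delta>'"
        using energy_bounded_near_step_functions[OF \<open>w \<in> Ap p\<close> \<open>1 < p\<close> \<open>admissible_kernel lam Lam w k\<close>
            \<open>0 < s\<close> \<open>s < 1\<close> \<open>0 < lam\<close> \<open>bounded \<Omega>\<close> T \<delta>'] by blast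
      have zero: "AE x in ?M. x \<notin> (\<Union>z\<in>Z. grid_cell h z) \<longrightarrow> v j x = 0" for j
      proof -
        have "AE x in lebesgue. x \<notin> \<Omega> \<longrightarrow> v j x = 0" using W0(2) bounded_seq by blast
        then have "AE x in ?M. x \<notin> \<Omega> \<longrightarrow> v j x = 0" by (simp add: AE_weight_measure_iff[OF w])
        then show ?thesis by (rule AE_mp, intro AE_I2 impI) (use Z(3) in blast)
      qed
      show ?thesis
        using finite_colouring_of_step_approximable[where M = ?M and Q = "grid_cell h" and Z = Z
            and m = "\<lambda>z. weight_mass w (grid_cell h z)" and v = v and p = p and B = "C * T" and \<delta> = \<delta>',
            OF vM p Z(1) _ _ _ zero _ B \<delta>' Z(4)[OF vm en]]
          emeasure_grid_cell[OF w Z(2)] weight_mass_grid_cell_pos[OF w Z(2)] C(1) T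
        unfolding \<delta>eq by simp
    qed
    obtain r :: "nat \<Rightarrow> nat" where r: "strict_mono r" and
      cau: "\<And>\<delta>. 0 < \<delta> \<Longrightarrow> \<exists>N. \<forall>i\<ge>N. \<forall>j\<ge>N.
        (\<integral>\<^sup>+x. ennreal (\<bar>v (r i) x - v (r j) x\<bar> powr p) \<partial>?M) \<le> ennreal \<delta>"
      using Cauchy_subseq_of_finite_colourings[OF colouring] by blast
    obtain u where um: "u \<in> borel_measurable ?M"
      and lim: "(\<lambda>j. \<integral>\<^sup>+x. ennreal (\<bar>v (r j) x - u x\<bar> powr p) \<partial>?M) \<longlonglongrightarrow> 0"
      using Lp_Cauchy_imp_convergent[of "\<lambda>j. v (r j)" ?M p, OF vM p cau] by blast
    have ul: "u \<in> borel_measurable lebesgue"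
      using um by (simp add: measurable_cong_sets[OF sets_weight_measure refl])
    have "(\<integral>\<^sup>+x. ennreal (\<bar>u x\<bar> powr p) \<partial>?M) < \<infinity>"
    proof -
      note um[measurable] vM[measurable]
      obtain j where j: "(\<integral>\<^sup>+x. ennreal (\<bar>v (r j) x - u x\<bar> powr p) \<partial>?M) < 1"
        using order_tendstoD(2)[OF lim, of 1] by (auto simp: eventually_sequentially)
      have "(\<integral>\<^sup>+x. ennreal (\<bar>u x\<bar> powr p) \<partial>?M)
         \<le> (\<integral>\<^sup>+x. ennreal (3 powr p) * (ennreal (\<bar>v (r j) x\<bar> powr p) + ennreal (\<bar>v (r j) x - u x\<bar> powr p)) \<partial>?M)"
      proof (rule nn_integral_mono)
        fix x
        show "ennreal (\<bar>u x\<bar> powr p)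
          \<le> ennreal (3 powr p) * (ennreal (\<bar>v (r j) x\<bar> powr p) + ennreal (\<bar>v (r j) x - u x\<bar> powr p))"
          using ennreal_leI[OF powr_abs_le_diff2[OF p, of "u x" "v (r j) x"]]
          by (simp add: ennreal_mult ennreal_plus)
      qed
      also have "\<dots> = ennreal (3 powr p) * ((\<integral>\<^sup>+x. ennreal (\<bar>v (r j) x\<bar> powr p) \<partial>?M)
          + (\<integral>\<^sup>+x. ennreal (\<bar>v (r j) x - u x\<bar> powr p) \<partial>?M))"
        by (subst nn_integral_cmult, measurable) (subst nn_integral_add, auto)
      also have "\<dots> < \<infinity>"
        using j order.strict_trans1[OF B[of "r j"] ennreal_less_top]
        by (auto simp: ennreal_mult_less_top intro: order.strict_trans)
      finally show ?thesis .
    qed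
    then have "u \<in> Lpw_space p w \<Omega>" by (rule mem[OF ul])
    moreover have "(\<lambda>j. Lpw_norm p w \<Omega> (\<lambda>x. v (r j) x - u x)) \<longlonglongrightarrow> 0"
    proof (rule tendsto_sandwich[OF _ _ tendsto_const tendsto_enn_powr_0[OF lim, of "1 / p"]])
      show "\<forall>\<^sub>F j in sequentially. Lpw_norm p w \<Omega> (\<lambda>x. v (r j) x - u x)
          \<le> enn_powr (\<integral>\<^sup>+x. ennreal (\<bar>v (r j) x - u x\<bar> powr p) \<partial>?M) (1 / p)"
        using ul vm by (intro always_eventually allI Lpw_norm_le[OF w p] borel_measurable_diff) auto
    qed (use p in auto)
    ultimately show ?thesis using r by blast
  qed
  ultimately show ?thesis
    unfolding compact_embedding_def by blast
qed

end
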